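(* Each set $\tilde I_k$ has cardinality $O(\frac1\varepsilon\log\frac1\varepsilon)$, so $G$ has $O(\frac1\varepsilon\log^2\frac1\varepsilon)$ items. The following algorithm constructs $G$ in time $O(\frac{1}{\varepsilon^2}\log^3\frac1\varepsilon)$ and space $O(\frac1\varepsilon\log^2\frac1\varepsilon)$, including the space to store $G$ and, for each item $\tilde a_{k,\gamma}$, the backtracking information (which two items of $\tilde I_{k-1}$ it was glued from, or that it is the item $a_{k,\gamma}$ of $I_L^{red}$): initialize $\tilde a_{k,\gamma}:=a_{k,\gamma}$ for all $k\in\{0,\dots,\kappa\}$ and $\gamma$; then for $k=0,\dots,\kappa-1$, for all $0\le\gamma\le\gamma'\le 2^{\kappa+1}(\kappa+1)-1$ such that $\tilde a_{k,\gamma},\tilde a_{k,\gamma'}$ exist and $s(\tilde a_{k,\gamma})+s(\tilde a_{k,\gamma'})\le c$, form $\tilde a=\tilde a_{k,\gamma}\oplus\tilde a_{k,\gamma'}$, determine $\gamma(\tilde a)$ with $p(\tilde a)\in L_{k+1,\gamma(\tilde a)}$, and replace $\tilde a_{k+1,\gamma(\tilde a)}$ by $\tilde a$ if the former does not exist or has larger size. Moreover, the item $a_{eff}^c$ can be constructed in time $O(1)$.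
   Context: UKP instance $I$: items with profits $p(a)\in(0,1]$, sizes $s(a)\in(0,1]$, capacity $c=1$. Let $\varepsilon=1/2^{\kappa-1}$, $\kappa\in\mathbb{N}$, $\varepsilon\le1/4$. Let $a_{me}$ maximize $p/s$ over $I$, $P_0=p(a_{me})\lfloor c/s(a_{me})\rfloor$, $T=\frac12\varepsilon P_0$, $K=\frac14\cdot\frac1{\kappa+1}\varepsilon T$, $I_L=\{a\in I:p(a)\ge T\}$, $I_S=I\setminus I_L$, $a_{eff}$ an item of $I_S$ maximizing $p/s$. For $k\in\{0,\dots,\kappa\}$, $L_k=[2^kT,2^{k+1}T)$ and for $\gamma\in\{0,\dots,2^{\kappa+1}(\kappa+1)-1\}$, $L_{k,\gamma}=[2^kT+\gamma2^kK,\ 2^kT+(\gamma+1)2^kK)$. $a_{k,\gamma}$ is an item of minimum size among items of $I_L$ with profit in $L_{k,\gamma}$ (if any), $I_L^{red}$ is the set of all existing $a_{k,\gamma}$ (given as an array indexed by $(k,\gamma)$), and $I_k=\{a\in I_L^{red}:p(a)\in L_k\}$. Gluing: for items $a_1,a_2$ with $s(a_1)+s(a_2)\le c$, $a_1\oplus a_2$ is an item of profit $p(a_1)+p(a_2)$ and size $s(a_1)+s(a_2)$. $\tilde I_0=I_0$; for $k=0,\dots,\kappa-1$ and each $\gamma$, $\tilde a_{k+1,\gamma}$ is an item of minimum size among the items of $I_{k+1}\cup\{\tilde a\oplus\tilde a':\tilde a,\tilde a'\in\tilde I_k,\ s(\tilde a)+s(\tilde a')\le c\}$ with profit in $L_{k+1,\gamma}$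 (if any), and $\tilde I_{k+1}$ is the set of existing $\tilde a_{k+1,\gamma}$. $G=\bigcup_{k=0}^{\kappa}\tilde I_k$. With $m=\lceil (P_0/4)/p(a_{eff})\rceil$, $a_{eff}^c$ is (if $m\,s(a_{eff})\le c$) the item of profit $m\,p(a_{eff})$ and size $m\,s(a_{eff})$. Computational model: basic arithmetic operations and logarithms take $O(1)$ time. *)

theory Defs
  imports Complex_Main
begin

section \<open>Unbounded knapsack: items, profit intervals, reduction, gluing\<close>

text \<open>An item is identified with its profit and size; the number of copies is unbounded, so
  coinciding items of an instance need not be distinguished.\<close>

datatype item = Item (prof: real) (sz: real)

abbreviation (input) cap :: real where "cap \<equiv> 1"

definition ukp_instance :: "item set \<Rightarrow> bool" where
  "ukp_instance I \<longleftrightarrow> finite I \<and> I \<noteq> {} \<and>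
     (\<forall>a\<in>I. 0 < prof a \<and> prof a \<le> 1 \<and> 0 < sz a \<and> sz a \<le> 1)"

definition most_efficient :: "item set \<Rightarrow> item \<Rightarrow> bool" where
  "most_efficient A a \<longleftrightarrow> is_arg_max (\<lambda>b. prof b / sz b) (\<lambda>b. b \<in> A) a"

text \<open>The truncated subtraction only affects \<open>\<kappa> = 0\<close>, which \<open>eps \<kappa> \<le> 1/4\<close> excludes.\<close>

definition eps :: "nat \<Rightarrow> real" where
  "eps \<kappa> = 1 / 2 ^ (\<kappa> - 1)"

definition P0 :: "item \<Rightarrow> real" where
  "P0 a_me = prof a_me * of_int \<lfloor>cap / sz a_me\<rfloor>"

definition T :: "nat \<Rightarrow> item \<Rightarrow> real" where
  "T \<kappa> a_me = 1/2 * eps \<kappa> * P0 a_me"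

definition K :: "nat \<Rightarrow> item \<Rightarrow> real" where
  "K \<kappa> a_me = 1/4 * (1 / (real \<kappa> + 1)) * eps \<kappa> * T \<kappa> a_me"

definition I_L :: "nat \<Rightarrow> item set \<Rightarrow> item \<Rightarrow> item set" where
  "I_L \<kappa> I a_me = {a \<in> I. prof a \<ge> T \<kappa> a_me}"

definition I_S :: "nat \<Rightarrow> item set \<Rightarrow> item \<Rightarrow> item set" where
  "I_S \<kappa> I a_me = I - I_L \<kappa> I a_me"

definition n_gam :: "nat \<Rightarrow> nat" where
  "n_gam \<kappa> = 2 ^ (\<kappa> + 1) * (\<kappa> + 1)"

definition L :: "nat \<Rightarrow> item \<Rightarrow> nat \<Rightarrow> real set" where
  "L \<kappa> a_me k = {2 ^ k * T \<kappa> a_me ..< 2 ^ (k + 1) * T \<kappa> a_me}"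

definition Lsub :: "nat \<Rightarrow> item \<Rightarrow> nat \<Rightarrow> nat \<Rightarrow> real set" where
  "Lsub \<kappa> a_me k \<gamma> =
     {2 ^ k * T \<kappa> a_me + real \<gamma> * 2 ^ k * K \<kappa> a_me ..<
      2 ^ k * T \<kappa> a_me + (real \<gamma> + 1) * 2 ^ k * K \<kappa> a_me}"

text \<open>Items of minimum size need not be unique. The arrays \<open>a\<^sub>k\<^sub>,\<^sub>\<gamma>\<close> below are therefore
  characterised by a predicate that admits every way of breaking ties.\<close>

definition min_size_choice :: "item set \<Rightarrow> item option \<Rightarrow> bool" where
  "min_size_choice A x \<longleftrightarrow>
     (case x of None \<Rightarrow> A = {} | Some a \<Rightarrow> is_arg_min sz (\<lambda>b. b \<in> A) a)"

type_synonym family = "nat \<Rightarrow> nat \<Rightarrow> item option"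

definition existing :: "nat \<Rightarrow> family \<Rightarrow> nat \<Rightarrow> item set" where
  "existing \<kappa> t k = {x. \<exists>\<gamma><n_gam \<kappa>. t k \<gamma> = Some x}"

definition is_reduced :: "nat \<Rightarrow> item set \<Rightarrow> item \<Rightarrow> family \<Rightarrow> bool" where
  "is_reduced \<kappa> I a_me a \<longleftrightarrow>
     (\<forall>k\<le>\<kappa>. \<forall>\<gamma><n_gam \<kappa>.
        min_size_choice {x \<in> I_L \<kappa> I a_me. prof x \<in> Lsub \<kappa> a_me k \<gamma>} (a k \<gamma>))"

definition I_L_red :: "nat \<Rightarrow> family \<Rightarrow> item set" where
  "I_L_red \<kappa> a = (\<Union>k\<le>\<kappa>. existing \<kappa> a k)"

definition I_level :: "nat \<Rightarrow> item \<Rightarrow> family \<Rightarrow> nat \<Rightarrow> item set" where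
  "I_level \<kappa> a_me a k = {x \<in> I_L_red \<kappa> a. prof x \<in> L \<kappa> a_me k}"

definition glue :: "item \<Rightarrow> item \<Rightarrow> item" (infixl "\<oplus>" 65) where
  "x \<oplus> y = Item (prof x + prof y) (sz x + sz y)"

text \<open>\<open>is_glued_family \<kappa> a_me a t\<close>: the array \<open>t\<close> is a legitimate choice of the items
  \<open>\<tilde>a\<^sub>k\<^sub>,\<^sub>\<gamma>\<close>, so that \<open>existing \<kappa> t k\<close> is the \<open>k\<close>-th glued set.\<close>

definition is_glued_family :: "nat \<Rightarrow> item \<Rightarrow> family \<Rightarrow> family \<Rightarrow> bool" where
  "is_glued_family \<kappa> a_me a t \<longleftrightarrow>
     existing \<kappa> t 0 = I_level \<kappa> a_me a 0 \<and>
     (\<forall>\<gamma><n_gam \<kappa>. t 0 \<gamma> = a 0 \<gamma>) \<and>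
     (\<forall>k<\<kappa>. \<forall>\<gamma><n_gam \<kappa>.
        min_size_choice
          {z \<in> I_level \<kappa> a_me a (k + 1) \<union>
               {x \<oplus> y | x y. x \<in> existing \<kappa> t k \<and> y \<in> existing \<kappa> t k \<and> sz x + sz y \<le> cap}.
             prof z \<in> Lsub \<kappa> a_me (k + 1) \<gamma>}
          (t (k + 1) \<gamma>))"

definition G :: "nat \<Rightarrow> family \<Rightarrow> item set" where
  "G \<kappa> t = (\<Union>k\<le>\<kappa>. existing \<kappa> t k)"

definition a_eff_c :: "item \<Rightarrow> item \<Rightarrow> item option" where
  "a_eff_c a_me a_eff =
     (let m = \<lceil>(P0 a_me / 4) / prof a_eff\<rceil> in
      if of_int m * sz a_eff \<le> cap
      then Some (Item (of_int m * prof a_eff) (of_int m * sz a_eff)) else None)"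


section \<open>Computational model\<close>

text \<open>A unit-cost random access machine on numbers, programmed in a small imperative language.
  Every node of an expression (constant, memory access, arithmetic operation, rounding,
  logarithm, comparison, connective), every assignment, branching and loop iteration takes one
  time unit. Space is the number of distinct memory cells that are read or written, which
  includes input and output cells.\<close>

datatype cell = Scalar string | Slot string nat

type_synonym memory = "cell \<Rightarrow> real"

datatype expr =
    Num real
  | Var string
  | Get string expr
  | Add expr expr (infixl "+\<^sub>e" 65)
  | Sub expr expr (infixl "-\<^sub>e" 65)
  | Mul expr expr (infixl "*\<^sub>e" 70)
  | Quot expr expr (infixl "'/\<^sub>e" 70)
  | Floor expr
  | Log2 expr

datatype test =
    Leq expr expr (infix "\<le>\<^sub>e" 50)
  | Less expr expr (infix "<\<^sub>e" 50)
  | Equal expr expr (infix "=\<^sub>e" 50)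
  | Conj test test (infixr "\<and>\<^sub>e" 35)
  | Disj test test (infixr "\<or>\<^sub>e" 30)
  | Neg test

datatype com =
    Skip
  | Assign string expr (infix "::=" 61)
  | Put string expr expr
  | Seq com com (infixr ";;" 60)
  | Cond test com com
  | For string expr expr com

definition addr :: "real \<Rightarrow> nat" where
  "addr v = nat \<lfloor>v\<rfloor>"

primrec eval :: "expr \<Rightarrow> memory \<Rightarrow> real" where
  "eval (Num r) m = r"
| "eval (Var x) m = m (Scalar x)"
| "eval (Get A e) m = m (Slot A (addr (eval e m)))"
| "eval (e +\<^sub>e f) m = eval e m + eval f m"
| "eval (e -\<^sub>e f) m = eval e m - eval f m"
| "eval (e *\<^sub>e f) m = eval e m * eval f m"
| "eval (e /\<^sub>e f) m = eval e m / eval f m"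
| "eval (Floor e) m = of_int \<lfloor>eval e m\<rfloor>"
| "eval (Log2 e) m = log 2 (eval e m)"

primrec expr_time :: "expr \<Rightarrow> nat" where
  "expr_time (Num r) = 1"
| "expr_time (Var x) = 1"
| "expr_time (Get A e) = 1 + expr_time e"
| "expr_time (e +\<^sub>e f) = 1 + expr_time e + expr_time f"
| "expr_time (e -\<^sub>e f) = 1 + expr_time e + expr_time f"
| "expr_time (e *\<^sub>e f) = 1 + expr_time e + expr_time f"
| "expr_time (e /\<^sub>e f) = 1 + expr_time e + expr_time f"
| "expr_time (Floor e) = 1 + expr_time e"
| "expr_time (Log2 e) = 1 + expr_time e"

primrec expr_cells :: "expr \<Rightarrow> memory \<Rightarrow> cell set" where
  "expr_cells (Num r) m = {}"
| "expr_cells (Var x) m = {Scalar x}"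
| "expr_cells (Get A e) m = {Slot A (addr (eval e m))} \<union> expr_cells e m"
| "expr_cells (e +\<^sub>e f) m = expr_cells e m \<union> expr_cells f m"
| "expr_cells (e -\<^sub>e f) m = expr_cells e m \<union> expr_cells f m"
| "expr_cells (e *\<^sub>e f) m = expr_cells e m \<union> expr_cells f m"
| "expr_cells (e /\<^sub>e f) m = expr_cells e m \<union> expr_cells f m"
| "expr_cells (Floor e) m = expr_cells e m"
| "expr_cells (Log2 e) m = expr_cells e m"

primrec holds :: "test \<Rightarrow> memory \<Rightarrow> bool" where
  "holds (e \<le>\<^sub>e f) m \<longleftrightarrow> eval e m \<le> eval f m"
| "holds (e <\<^sub>e f) m \<longleftrightarrow> eval e m < eval f m"
| "holds (e =\<^sub>e f) m \<longleftrightarrow> eval e m = eval f m"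
| "holds (b \<and>\<^sub>e d) m \<longleftrightarrow> holds b m \<and> holds d m"
| "holds (b \<or>\<^sub>e d) m \<longleftrightarrow> holds b m \<or> holds d m"
| "holds (Neg b) m \<longleftrightarrow> \<not> holds b m"

primrec test_time :: "test \<Rightarrow> nat" where
  "test_time (e \<le>\<^sub>e f) = 1 + expr_time e + expr_time f"
| "test_time (e <\<^sub>e f) = 1 + expr_time e + expr_time f"
| "test_time (e =\<^sub>e f) = 1 + expr_time e + expr_time f"
| "test_time (b \<and>\<^sub>e d) = 1 + test_time b + test_time d"
| "test_time (b \<or>\<^sub>e d) = 1 + test_time b + test_time d"
| "test_time (Neg b) = 1 + test_time b"

primrec test_cells :: "test \<Rightarrow> memory \<Rightarrow> cell set" where
  "test_cells (e \<le>\<^sub>e f) m = expr_cells e m \<union> expr_cells f m"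
| "test_cells (e <\<^sub>e f) m = expr_cells e m \<union> expr_cells f m"
| "test_cells (e =\<^sub>e f) m = expr_cells e m \<union> expr_cells f m"
| "test_cells (b \<and>\<^sub>e d) m = test_cells b m \<union> test_cells d m"
| "test_cells (b \<or>\<^sub>e d) m = test_cells b m \<union> test_cells d m"
| "test_cells (Neg b) m = test_cells b m"

record config =
  mem :: memory
  elapsed :: nat
  touched :: "cell set"

definition charge :: "nat \<Rightarrow> cell set \<Rightarrow> config \<Rightarrow> config" where
  "charge n S r = r\<lparr>elapsed := elapsed r + n, touched := touched r \<union> S\<rparr>"

definition store :: "cell \<Rightarrow> real \<Rightarrow> config \<Rightarrow> config" where
  "store l v r = r\<lparr>mem := (mem r)(l := v), touched := insert l (touched r)\<rparr>"

text \<open>The bounds of a loop are inclusive and evaluated once, on entry.\<close>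

primrec exec :: "com \<Rightarrow> config \<Rightarrow> config" where
  "exec Skip r = r"
| "exec (x ::= e) r =
     store (Scalar x) (eval e (mem r))
       (charge (1 + expr_time e) (expr_cells e (mem r)) r)"
| "exec (Put A i e) r =
     store (Slot A (addr (eval i (mem r)))) (eval e (mem r))
       (charge (1 + expr_time i + expr_time e)
          (expr_cells i (mem r) \<union> expr_cells e (mem r)) r)"
| "exec (c ;; d) r = exec d (exec c r)"
| "exec (Cond b c d) r =
     (let r' = charge (1 + test_time b) (test_cells b (mem r)) r
      in if holds b (mem r) then exec c r' else exec d r')"
| "exec (For x lo hi c) r =
     fold (\<lambda>i r'. exec c (store (Scalar x) (of_int i) (charge 1 {} r')))
       [\<lfloor>eval lo (mem r)\<rfloor>..\<lfloor>eval hi (mem r)\<rfloor>]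
       (charge (1 + expr_time lo + expr_time hi)
          ({Scalar x} \<union> expr_cells lo (mem r) \<union> expr_cells hi (mem r)) r)"

definition run :: "com \<Rightarrow> memory \<Rightarrow> config" where
  "run c m = exec c \<lparr>mem = m, elapsed = 0, touched = {}\<rparr>"


section \<open>The gluing algorithm\<close>

text \<open>Two-dimensional arrays are stored row by row. A family of items occupies three arrays:
  an existence flag, the profit and the size.\<close>

definition idx :: "nat \<Rightarrow> nat \<Rightarrow> nat \<Rightarrow> nat" where
  "idx \<kappa> k \<gamma> = k * n_gam \<kappa> + \<gamma>"

definition stores_item :: "string \<Rightarrow> string \<Rightarrow> string \<Rightarrow> nat \<Rightarrow> item option \<Rightarrow> memory \<Rightarrow> bool" where
  "stores_item E P S i x m \<longleftrightarrow>
     (case x of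
        None \<Rightarrow> m (Slot E i) = 0
      | Some a \<Rightarrow> m (Slot E i) = 1 \<and> m (Slot P i) = prof a \<and> m (Slot S i) = sz a)"

definition stores_family :: "nat \<Rightarrow> string \<Rightarrow> string \<Rightarrow> string \<Rightarrow> family \<Rightarrow> memory \<Rightarrow> bool" where
  "stores_family \<kappa> E P S t m \<longleftrightarrow>
     (\<forall>k\<le>\<kappa>. \<forall>\<gamma><n_gam \<kappa>. stores_item E P S (idx \<kappa> k \<gamma>) (t k \<gamma>) m)"

definition glue_input :: "nat \<Rightarrow> item \<Rightarrow> family \<Rightarrow> memory \<Rightarrow> bool" where
  "glue_input \<kappa> a_me a m \<longleftrightarrow>
     m (Scalar ''eps'') = eps \<kappa> \<and> m (Scalar ''P0'') = P0 a_me \<and>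
     stores_family \<kappa> ''a_ex'' ''a_p'' ''a_s'' a m"

text \<open>Backtracking information of an existing item \<open>t k \<gamma>\<close>: origin \<open>0\<close> marks the item
  \<open>a k \<gamma>\<close> of the reduced instance; origin \<open>1\<close> marks a glued item, whose two parts are found in
  row \<open>k - 1\<close> at the positions held by the arrays \<open>left\<close> and \<open>right\<close>.\<close>

definition stores_backtracking :: "nat \<Rightarrow> family \<Rightarrow> family \<Rightarrow> memory \<Rightarrow> bool" where
  "stores_backtracking \<kappa> a t m \<longleftrightarrow>
     (\<forall>k\<le>\<kappa>. \<forall>\<gamma><n_gam \<kappa>. t k \<gamma> \<noteq> None \<longrightarrow>
        m (Slot ''origin'' (idx \<kappa> k \<gamma>)) = 0 \<and> t k \<gamma> = a k \<gamma> \<or>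
        m (Slot ''origin'' (idx \<kappa> k \<gamma>)) = 1 \<and> k > 0 \<and>
        (\<exists>g<n_gam \<kappa>. \<exists>h<n_gam \<kappa>. \<exists>x y.
           m (Slot ''left'' (idx \<kappa> k \<gamma>)) = real g \<and>
           m (Slot ''right'' (idx \<kappa> k \<gamma>)) = real h \<and>
           t (k - 1) g = Some x \<and> t (k - 1) h = Some y \<and>
           sz x + sz y \<le> cap \<and> t k \<gamma> = Some (x \<oplus> y)))"

text \<open>Since \<open>\<epsilon> = 1/2\<^bsup>\<kappa>-1\<^esup>\<close>, we have \<open>\<kappa> = log\<^sub>2 (1/\<epsilon>) + 1\<close> and \<open>2\<^bsup>\<kappa>+1\<^esup> = 4/\<epsilon>\<close>.\<close>

definition glue_setup :: com where
  "glue_setup =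
     ''kappa'' ::= Log2 (Num 1 /\<^sub>e Var ''eps'') +\<^sub>e Num 1 ;;
     ''n'' ::= Num 4 /\<^sub>e Var ''eps'' *\<^sub>e (Var ''kappa'' +\<^sub>e Num 1) ;;
     ''T'' ::= Num (1/2) *\<^sub>e Var ''eps'' *\<^sub>e Var ''P0'' ;;
     ''K'' ::= Num (1/4) *\<^sub>e (Num 1 /\<^sub>e (Var ''kappa'' +\<^sub>e Num 1)) *\<^sub>e Var ''eps'' *\<^sub>e Var ''T''"

definition glue_init :: com where
  "glue_init =
     For ''k'' (Num 0) (Var ''kappa'')
       (For ''g'' (Num 0) (Var ''n'' -\<^sub>e Num 1)
         (''i'' ::= Var ''k'' *\<^sub>e Var ''n'' +\<^sub>e Var ''g'' ;;
          Put ''t_ex'' (Var ''i'') (Get ''a_ex'' (Var ''i'')) ;;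
          Put ''t_p'' (Var ''i'') (Get ''a_p'' (Var ''i'')) ;;
          Put ''t_s'' (Var ''i'') (Get ''a_s'' (Var ''i'')) ;;
          Put ''origin'' (Var ''i'') (Num 0)))"

text \<open>An item glued from row \<open>k\<close> has its profit in \<open>L\<^bsub>k+1\<^esub>\<close>; its position \<open>\<gamma>\<close> there is
  \<open>\<lfloor>(p - 2\<^bsup>k+1\<^esup> T) / (2\<^bsup>k+1\<^esup> K)\<rfloor>\<close>. The variable \<open>pow\<close> holds \<open>2\<^bsup>k+1\<^esup>\<close>.\<close>

definition glue_pair :: com where
  "glue_pair =
     ''i'' ::= Var ''k'' *\<^sub>e Var ''n'' +\<^sub>e Var ''g'' ;;
     ''j'' ::= Var ''k'' *\<^sub>e Var ''n'' +\<^sub>e Var ''h'' ;;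
     Cond (Get ''t_ex'' (Var ''i'') =\<^sub>e Num 1 \<and>\<^sub>e
           Get ''t_ex'' (Var ''j'') =\<^sub>e Num 1 \<and>\<^sub>e
           Get ''t_s'' (Var ''i'') +\<^sub>e Get ''t_s'' (Var ''j'') \<le>\<^sub>e Num cap)
       (''p'' ::= Get ''t_p'' (Var ''i'') +\<^sub>e Get ''t_p'' (Var ''j'') ;;
        ''s'' ::= Get ''t_s'' (Var ''i'') +\<^sub>e Get ''t_s'' (Var ''j'') ;;
        ''gam'' ::= Floor ((Var ''p'' -\<^sub>e Var ''pow'' *\<^sub>e Var ''T'') /\<^sub>e
                          (Var ''pow'' *\<^sub>e Var ''K'')) ;;
        ''q'' ::= (Var ''k'' +\<^sub>e Num 1) *\<^sub>e Var ''n'' +\<^sub>e Var ''gam'' ;;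
        Cond (Get ''t_ex'' (Var ''q'') =\<^sub>e Num 0 \<or>\<^sub>e Var ''s'' <\<^sub>e Get ''t_s'' (Var ''q''))
          (Put ''t_ex'' (Var ''q'') (Num 1) ;;
           Put ''t_p'' (Var ''q'') (Var ''p'') ;;
           Put ''t_s'' (Var ''q'') (Var ''s'') ;;
           Put ''origin'' (Var ''q'') (Num 1) ;;
           Put ''left'' (Var ''q'') (Var ''g'') ;;
           Put ''right'' (Var ''q'') (Var ''h''))
          Skip)
       Skip"

definition glue_alg :: com where
  "glue_alg =
     glue_setup ;;
     glue_init ;;
     ''pow'' ::= Num 1 ;;
     For ''k'' (Num 0) (Var ''kappa'' -\<^sub>e Num 1)
       (''pow'' ::= Num 2 *\<^sub>e Var ''pow'' ;;
        For ''g'' (Num 0) (Var ''n'' -\<^sub>e Num 1)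
          (For ''h'' (Var ''g'') (Var ''n'' -\<^sub>e Num 1) glue_pair))"

definition eff_input :: "item \<Rightarrow> item \<Rightarrow> memory \<Rightarrow> bool" where
  "eff_input a_me a_eff m \<longleftrightarrow>
     m (Scalar ''P0'') = P0 a_me \<and>
     m (Scalar ''p_eff'') = prof a_eff \<and> m (Scalar ''s_eff'') = sz a_eff"

end

theory Submission
  imports Defs
begin

text \<open>The loops process the triples \<open>(k, g, h)\<close> in lexicographic order. The invariant says that
  every \<open>t (k + 1) \<gamma>\<close> is of minimum size among the items of the reduced instance and the items
  glued from the pairs of row \<open>k\<close> that have been processed so far. While row \<open>k\<close> is being
  processed, only row \<open>k + 1\<close> changes, and no pair of that row has been processed yet; hence the
  candidates and the backtracking information of the other rows are unaffected.\<close>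

section \<open>The parameters\<close>

text \<open>Two numerical facts keep every write inside the right row. The width \<open>K\<close> is
  scaled so that \<open>n_gam \<kappa> * K = T\<close>, hence the subintervals of a level tile
  \<open>L\<close> exactly; and the endpoints of the levels double, so two profits of one level add
  up to a profit of the next. The position computed by \<open>Floor\<close> is therefore always a
  legitimate entry of row \<open>k + 1\<close>. Items of minimum size are not unique, so the family
  that the run produces depends on the order of the pairs and on the input memory. It is
  existentially quantified in the memory invariant \<open>glued_memory\<close> and fixed only while
  one pair is processed. The program visits only \<open>g \<le> h\<close>, whereas the specification
  ranges over all ordered pairs; commutativity of gluing closes this gap. Space is bounded by
  exhibiting one fixed finite set of cells that contains everything touched. The assumption on
  \<open>eps\<close> enters as \<open>3 \<le> \<kappa>\<close>, that is
  \<open>\<kappa> + 1 \<le> 2 * (\<kappa> - 1)\<close>, which turns counts in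
  \<open>\<kappa>\<close> into multiples of \<open>log 2 (1 / eps \<kappa>)\<close>.\<close>

lemma eps_le_quarter_iff: "eps \<kappa> \<le> 1/4 \<longleftrightarrow> 3 \<le> \<kappa>"
proof
  assume le: "eps \<kappa> \<le> 1/4"
  show "3 \<le> \<kappa>"
  proof (rule ccontr)
    assume "\<not> 3 \<le> \<kappa>"
    then have "\<kappa> = 0 \<or> \<kappa> = 1 \<or> \<kappa> = 2" by auto
    with le show False by (auto simp: eps_def)
  qed
next
  assume "3 \<le> \<kappa>"
  then have "(2::real) ^ 2 \<le> 2 ^ (\<kappa> - 1)" by (intro power_increasing) auto
  then show "eps \<kappa> \<le> 1/4" by (simp add: eps_def field_simps)
qed

lemma inverse_eps: "1 / eps \<kappa> = 2 ^ (\<kappa> - 1)"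
  by (simp add: eps_def)

lemma log_inverse_eps: "log 2 (1 / eps \<kappa>) = real (\<kappa> - 1)"
  by (simp add: inverse_eps)

text \<open>This is the formula by which the program computes the row length. It fails for
  \<open>\<kappa> = 0\<close>, where truncated subtraction gives \<open>eps 0 = 1\<close> and hence
  4 instead of 2.\<close>

lemma n_gam_eq:
  assumes "1 \<le> \<kappa>"
  shows "real (n_gam \<kappa>) = 4 / eps \<kappa> * (real \<kappa> + 1)"
  using assms by (cases \<kappa>) (simp_all add: n_gam_def eps_def algebra_simps)

text \<open>All factors other than \<open>T\<close> cancel. Scaled by \<open>2 ^ k\<close>, it says
  that the subintervals of level \<open>k\<close> together are exactly as long as
  \<open>L\<close>.\<close>

lemma n_gam_mult_K:
  assumes "1 \<le> \<kappa>"
  shows "real (n_gam \<kappa>) * K \<kappa> b = T \<kappa> b"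
proof -
  have "eps \<kappa> \<noteq> 0" "real \<kappa> + 1 \<noteq> 0" by (simp_all add: eps_def)
  then show ?thesis
    unfolding n_gam_eq[OF assms] K_def by simp
qed

lemma n_gam_pos: "0 < n_gam \<kappa>"
  by (simp add: n_gam_def)

lemma n_gam_le:
  assumes "3 \<le> \<kappa>"
  shows "real (n_gam \<kappa>) \<le> 8 * (1 / eps \<kappa> * log 2 (1 / eps \<kappa>))"
proof -
  \<comment> \<open>This inequality is equivalent to \<open>3 \<le> \<kappa>\<close>; the constant 8
    below is 4 times this factor 2.\<close>
  have "real \<kappa> + 1 \<le> 2 * real (\<kappa> - 1)"
    using assms by (simp add: of_nat_diff)
  then have "4 * 2 ^ (\<kappa> - 1) * (real \<kappa> + 1) \<le> 4 * 2 ^ (\<kappa> - 1) * (2 * real (\<kappa> - 1))"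
    by (intro mult_left_mono) auto
  moreover have "real (n_gam \<kappa>) = 4 * 2 ^ (\<kappa> - 1) * (real \<kappa> + 1)"
    using n_gam_eq[of \<kappa>] assms by (simp add: eps_def)
  ultimately show ?thesis
    unfolding log_inverse_eps by (simp add: eps_def)
qed

lemma rows_le:
  assumes "3 \<le> \<kappa>"
  shows "real (\<kappa> + 1) \<le> 2 * log 2 (1 / eps \<kappa>)"
  unfolding log_inverse_eps using assms by (simp add: of_nat_diff)

lemma log_inverse_eps_nonneg: "0 \<le> log 2 (1 / eps \<kappa>)"
  unfolding log_inverse_eps by simp

lemma rows_mult_n_gam_le:
  assumes "3 \<le> \<kappa>"
  shows "real ((\<kappa> + 1) * n_gam \<kappa>) \<le> 16 * (1 / eps \<kappa> * (log 2 (1 / eps \<kappa>))\<^sup>2)"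
proof -
  have "real ((\<kappa> + 1) * n_gam \<kappa>) \<le>
      (2 * log 2 (1 / eps \<kappa>)) * (8 * (1 / eps \<kappa> * log 2 (1 / eps \<kappa>)))"
    unfolding of_nat_mult
    by (intro mult_mono rows_le n_gam_le assms) (use log_inverse_eps_nonneg in auto)
  also have "\<dots> = 16 * (1 / eps \<kappa> * (log 2 (1 / eps \<kappa>))\<^sup>2)"
    by (simp add: power2_eq_square)
  finally show ?thesis .
qed

lemma rows_mult_n_gam_square_le:
  assumes "3 \<le> \<kappa>"
  shows "real ((\<kappa> + 1) * n_gam \<kappa> * n_gam \<kappa>)
    \<le> 128 * (1 / (eps \<kappa>)\<^sup>2 * (log 2 (1 / eps \<kappa>)) ^ 3)"
proof -
  have "real ((\<kappa> + 1) * n_gam \<kappa> * n_gam \<kappa>) \<le>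
      (16 * (1 / eps \<kappa> * (log 2 (1 / eps \<kappa>))\<^sup>2)) * (8 * (1 / eps \<kappa> * log 2 (1 / eps \<kappa>)))"
    \<comment> \<open>The instantiation splits only the outer product, so that
      \<open>(\<kappa> + 1) * n_gam \<kappa>\<close> stays intact for the preceding bound.\<close>
    unfolding of_nat_mult[of "_ * _"]
    by (intro mult_mono rows_mult_n_gam_le n_gam_le assms)
      (use log_inverse_eps_nonneg in \<open>auto simp: eps_def\<close>)
  also have "\<dots> = 128 * (1 / (eps \<kappa>)\<^sup>2 * (log 2 (1 / eps \<kappa>)) ^ 3)"
    by (simp add: power2_eq_square power3_eq_cube)
  finally show ?thesis .
qed


section \<open>Cardinalities\<close>

lemma existing_subset: "existing \<kappa> t k \<subseteq> (\<lambda>\<gamma>. the (t k \<gamma>)) ` {..<n_gam \<kappa>}"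
proof
  fix x assume "x \<in> existing \<kappa> t k"
  then obtain \<gamma> where "\<gamma> < n_gam \<kappa>" "t k \<gamma> = Some x" by (auto simp: existing_def)
  then show "x \<in> (\<lambda>\<gamma>. the (t k \<gamma>)) ` {..<n_gam \<kappa>}" by (intro image_eqI[of _ _ \<gamma>]) simp_all
qed

lemma finite_existing: "finite (existing \<kappa> t k)"
  by (rule finite_subset[OF existing_subset]) simp

lemma card_existing_le: "card (existing \<kappa> t k) \<le> n_gam \<kappa>"
  using surj_card_le[OF _ existing_subset[of \<kappa> t k]] by simp

lemma finite_G: "finite (G \<kappa> t)"
  by (simp add: G_def finite_existing)

lemma card_G_le: "card (G \<kappa> t) \<le> (\<kappa> + 1) * n_gam \<kappa>"
proof -
  have "card (G \<kappa> t) \<le> (\<Sum>k\<le>\<kappa>. card (existing \<kappa> t k))"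
    unfolding G_def by (rule card_UN_le) simp
  also have "\<dots> \<le> (\<Sum>k\<le>\<kappa>. n_gam \<kappa>)"
    by (intro sum_mono card_existing_le)
  finally show ?thesis by simp
qed


section \<open>Hoare triples with time and space bounds\<close>

text \<open>\<open>exec\<close> is a total function, so correctness, time and space fit into one
  statement about its result. Times add up under composition, while \<open>S\<close> is the same
  throughout, since touching a cell again costs no space.\<close>

definition triple :: "cell set \<Rightarrow> (memory \<Rightarrow> bool) \<Rightarrow> com \<Rightarrow> nat \<Rightarrow> (memory \<Rightarrow> bool) \<Rightarrow> bool" where
  "triple S P c \<tau> Q \<longleftrightarrow> (\<forall>r. P (mem r) \<longrightarrow>
     Q (mem (exec c r)) \<and> elapsed (exec c r) \<le> elapsed r + \<tau> \<and>
     touched (exec c r) \<subseteq> touched r \<union> S)"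

lemma triple_seq:
  assumes "triple S P c \<tau> Q" "triple S Q d \<upsilon> R"
  shows "triple S P (c ;; d) (\<tau> + \<upsilon>) R"
  unfolding triple_def
proof (intro allI impI)
  fix r :: config assume "P (mem r)"
  then have c: "Q (mem (exec c r))" "elapsed (exec c r) \<le> elapsed r + \<tau>"
    "touched (exec c r) \<subseteq> touched r \<union> S"
    using assms(1) unfolding triple_def by blast+
  moreover have "R (mem (exec d (exec c r)))"
    "elapsed (exec d (exec c r)) \<le> elapsed (exec c r) + \<upsilon>"
    "touched (exec d (exec c r)) \<subseteq> touched (exec c r) \<union> S"
    using assms(2) c(1) unfolding triple_def by blast+
  ultimately show "R (mem (exec (c ;; d) r)) \<and> elapsed (exec (c ;; d) r) \<le> elapsed r + (\<tau> + \<upsilon>) \<and>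
     touched (exec (c ;; d) r) \<subseteq> touched r \<union> S"
    by auto
qed

lemma triple_assign:
  assumes "\<And>m. P m \<Longrightarrow> Q (m(Scalar x := eval e m)) \<and> insert (Scalar x) (expr_cells e m) \<subseteq> S"
    and "1 + expr_time e \<le> \<tau>"
  shows "triple S P (x ::= e) \<tau> Q"
  using assms unfolding triple_def by (auto simp: store_def charge_def)

lemma triple_put:
  assumes "\<And>m. P m \<Longrightarrow> Q (m(Slot A (addr (eval i m)) := eval e m)) \<and>
      insert (Slot A (addr (eval i m))) (expr_cells i m \<union> expr_cells e m) \<subseteq> S"
    and "1 + expr_time i + expr_time e \<le> \<tau>"
  shows "triple S P (Put A i e) \<tau> Q"
  using assms unfolding triple_def by (auto simp: store_def charge_def)

lemma triple_cond:
  assumes "\<And>m. P m \<Longrightarrow> test_cells b m \<subseteq> S"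
    and "triple S (\<lambda>m. P m \<and> holds b m) c \<tau> Q"
    and "triple S (\<lambda>m. P m \<and> \<not> holds b m) d \<tau> Q"
  shows "triple S P (Cond b c d) (1 + test_time b + \<tau>) Q"
  unfolding triple_def
proof (intro allI impI)
  fix r :: config assume P: "P (mem r)"
  define r' where "r' = charge (1 + test_time b) (test_cells b (mem r)) r"
  define e where "e = (if holds b (mem r) then c else d)"
  have r': "mem r' = mem r" "elapsed r' = elapsed r + (1 + test_time b)"
    "touched r' \<subseteq> touched r \<union> S"
    using assms(1)[OF P] by (auto simp: r'_def charge_def)
  have "Q (mem (exec e r')) \<and> elapsed (exec e r') \<le> elapsed r' + \<tau> \<and>
      touched (exec e r') \<subseteq> touched r' \<union> S"
    using assms(2,3) P r'(1) by (simp add: triple_def e_def)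
  moreover have "exec (Cond b c d) r = exec e r'"
    by (simp add: r'_def e_def)
  ultimately show "Q (mem (exec (Cond b c d) r)) \<and>
      elapsed (exec (Cond b c d) r) \<le> elapsed r + (1 + test_time b + \<tau>) \<and>
      touched (exec (Cond b c d) r) \<subseteq> touched r \<union> S"
    using r' by auto
qed

lemma triple_skip: "(\<And>m. P m \<Longrightarrow> Q m) \<Longrightarrow> triple S P Skip \<tau> Q"
  by (auto simp: triple_def)

lemma triple_False: "(\<And>m. \<not> P m) \<Longrightarrow> triple S P c \<tau> Q"
  by (simp add: triple_def)

text \<open>\<open>Inv i\<close> describes the memory when the indices below \<open>i\<close> are
  done, and \<open>u\<close> is exclusive, whereas the bounds of \<open>For\<close> are inclusive;
  hence the \<open>- 1\<close>. The case \<open>l = u\<close> is the empty loop. Every iteration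
  first overwrites the loop variable, so \<open>var\<close> demands that the invariant ignore it,
  and the body receives its value as a separate conjunct.\<close>

lemma triple_for:
  assumes bounds: "\<And>m. P m \<Longrightarrow> \<lfloor>eval lo m\<rfloor> = int l \<and> \<lfloor>eval hi m\<rfloor> = int u - 1 \<and>
      insert (Scalar x) (expr_cells lo m \<union> expr_cells hi m) \<subseteq> S"
    and "l \<le> u"
    and init: "\<And>m. P m \<Longrightarrow> Inv l m"
    and step: "\<And>i. \<lbrakk>l \<le> i; i < u\<rbrakk> \<Longrightarrow>
      triple S (\<lambda>m. m (Scalar x) = real i \<and> Inv i m) c \<tau> (Inv (Suc i))"
    and var: "\<And>i m v. Inv i m \<Longrightarrow> Inv i (m(Scalar x := v))"
    and post: "\<And>m. Inv u m \<Longrightarrow> Q m"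
  shows "triple S P (For x lo hi c)
    (1 + expr_time lo + expr_time hi + (u - l) * (1 + \<tau>)) Q"
  unfolding triple_def
proof (intro allI impI)
  fix r :: config assume P: "P (mem r)"
  have S: "Scalar x \<in> S" using bounds[OF P] by auto
  define r0 where "r0 = charge (1 + expr_time lo + expr_time hi)
          ({Scalar x} \<union> expr_cells lo (mem r) \<union> expr_cells hi (mem r)) r"
  define f where "f = (\<lambda>i r'. exec c (store (Scalar x) (of_int i) (charge 1 {} r')))"
  have r0: "mem r0 = mem r" "elapsed r0 = elapsed r + (1 + expr_time lo + expr_time hi)"
    "touched r0 \<subseteq> touched r \<union> S"
    using bounds[OF P] by (auto simp: r0_def charge_def)
  \<comment> \<open>The upper end is generalised to \<open>v\<close>, so that the induction can
    split off the last iteration.\<close>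
  have loop: "Inv v (mem (fold f [int l..int v - 1] r0)) \<and>
      elapsed (fold f [int l..int v - 1] r0) \<le> elapsed r0 + (v - l) * (1 + \<tau>) \<and>
      touched (fold f [int l..int v - 1] r0) \<subseteq> touched r0 \<union> S" if "l \<le> v" "v \<le> u" for v
    using that
  proof (induction v rule: dec_induct)
    case base
    then show ?case using init[OF P] r0 by simp
  next
    case (step v)
    define r1 where "r1 = fold f [int l..int v - 1] r0"
    define r2 where "r2 = store (Scalar x) (real v) (charge 1 {} r1)"
    have IH: "Inv v (mem r1)" "elapsed r1 \<le> elapsed r0 + (v - l) * (1 + \<tau>)"
      "touched r1 \<subseteq> touched r0 \<union> S"
      using step unfolding r1_def by auto
    have "[int l..int (Suc v) - 1] = [int l..int v - 1] @ [int v]"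
      using upto_rec2[of "int l" "int v"] step by simp
    then have fold: "fold f [int l..int (Suc v) - 1] r0 = exec c r2"
      by (simp add: r1_def r2_def f_def)
    have r2: "mem r2 (Scalar x) = real v" "Inv v (mem r2)" "elapsed r2 = elapsed r1 + 1"
      "touched r2 = insert (Scalar x) (touched r1)"
      using var[OF IH(1)] by (auto simp: r2_def store_def charge_def)
    have "triple S (\<lambda>m. m (Scalar x) = real v \<and> Inv v m) c \<tau> (Inv (Suc v))"
      using assms(4)[of v] step by simp
    then have "Inv (Suc v) (mem (exec c r2)) \<and> elapsed (exec c r2) \<le> elapsed r2 + \<tau> \<and>
        touched (exec c r2) \<subseteq> touched r2 \<union> S"
      using r2 unfolding triple_def by blast
    moreover have "Suc v - l = Suc (v - l)" using step by simp
    ultimately show ?case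
      unfolding fold using IH r2 S by auto
  qed
  have exec: "exec (For x lo hi c) r = fold f [int l..int u - 1] r0"
    using bounds[OF P] by (simp add: r0_def f_def)
  show "Q (mem (exec (For x lo hi c) r)) \<and>
    elapsed (exec (For x lo hi c) r)
      \<le> elapsed r + (1 + expr_time lo + expr_time hi + (u - l) * (1 + \<tau>)) \<and>
    touched (exec (For x lo hi c) r) \<subseteq> touched r \<union> S"
    unfolding exec using loop[OF \<open>l \<le> u\<close> order.refl] r0 post by auto
qed

lemma triple_conseq:
  assumes "triple S P c \<tau> Q" "\<And>m. P' m \<Longrightarrow> P m" "\<tau> \<le> \<tau>'" "\<And>m. Q m \<Longrightarrow> Q' m"
  shows "triple S P' c \<tau>' Q'"
  using assms unfolding triple_def by (meson add_left_mono le_trans)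


section \<open>The items found so far\<close>

text \<open>Correctness of one replacement step. The comparison is strict, so the old item survives
  a tie, which leaves it a minimum. For \<open>x = None\<close> the first disjunct decides and the
  value of \<open>the x\<close> is irrelevant.\<close>

lemma min_size_choice_insert:
  assumes "min_size_choice A x"
  shows "min_size_choice (insert z A)
    (if x = None \<or> sz z < sz (the x) then Some z else x)"
  using assms unfolding min_size_choice_def is_arg_min_def
  by (auto split: option.splits if_splits)

locale reduced_instance =
  fixes \<kappa> :: nat and I :: "item set" and a_me :: item and a :: family
  assumes inst: "ukp_instance I"
    and kappa: "3 \<le> \<kappa>"
    and me: "most_efficient I a_me"
    and red: "is_reduced \<kappa> I a_me a"
begin

section \<open>Geometry of the profit intervals and rows of the reduced instance\<close>

lemma T_pos: "0 < T \<kappa> a_me"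
proof -
  have a_me: "0 < prof a_me" "0 < sz a_me" "sz a_me \<le> 1"
    using me inst by (auto simp: most_efficient_def is_arg_max_def ukp_instance_def)
  then have "1 \<le> \<lfloor>1 / sz a_me\<rfloor>" by (simp add: le_floor_iff)
  then show ?thesis using a_me by (simp add: T_def P0_def eps_def)
qed

lemma K_pos: "0 < K \<kappa> a_me"
  using T_pos by (simp add: K_def eps_def)

text \<open>Connects the interval with the expression that the program evaluates. Since a floor has
  only one value, disjointness of the subintervals of a level comes for free.\<close>

lemma mem_Lsub_iff:
  "x \<in> Lsub \<kappa> a_me k \<gamma> \<longleftrightarrow>
    \<lfloor>(x - 2 ^ k * T \<kappa> a_me) / (2 ^ k * K \<kappa> a_me)\<rfloor> = int \<gamma>"
proof -
  have "0 < 2 ^ k * K \<kappa> a_me" using K_pos by simp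
  then show ?thesis
    unfolding Lsub_def floor_eq_iff
    by (auto simp: pos_le_divide_eq pos_divide_less_eq algebra_simps)
qed

lemma Lsub_subset_L:
  assumes "\<gamma> < n_gam \<kappa>"
  shows "Lsub \<kappa> a_me k \<gamma> \<subseteq> L \<kappa> a_me k"
proof -
  have "(real \<gamma> + 1) * K \<kappa> a_me \<le> real (n_gam \<kappa>) * K \<kappa> a_me"
    using assms K_pos by (intro mult_right_mono) auto
  then have "(real \<gamma> + 1) * K \<kappa> a_me \<le> T \<kappa> a_me"
    using n_gam_mult_K kappa by simp
  then have "2 ^ k * ((real \<gamma> + 1) * K \<kappa> a_me) \<le> 2 ^ k * T \<kappa> a_me"
    by (intro mult_left_mono) auto
  moreover have "0 \<le> real \<gamma> * 2 ^ k * K \<kappa> a_me" using K_pos by simp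
  ultimately show ?thesis
    unfolding Lsub_def L_def atLeastLessThan_iff subset_iff power_Suc Suc_eq_plus1[symmetric]
    by (auto simp: algebra_simps)
qed

text \<open>Exact tiling: a profit below the upper end of the level has quotient below
  \<open>n_gam \<kappa>\<close>, because the length of the level is \<open>n_gam \<kappa>\<close>
  subinterval widths.\<close>

lemma ex_Lsub:
  assumes "x \<in> L \<kappa> a_me k"
  obtains \<gamma> where "\<gamma> < n_gam \<kappa>" "x \<in> Lsub \<kappa> a_me k \<gamma>"
proof -
  let ?q = "(x - 2 ^ k * T \<kappa> a_me) / (2 ^ k * K \<kappa> a_me)"
  have pos: "0 < 2 ^ k * K \<kappa> a_me" using K_pos by simp
  have "0 \<le> ?q" using assms pos by (auto simp: L_def intro!: divide_nonneg_pos)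
  have "x - 2 ^ k * T \<kappa> a_me < 2 ^ k * T \<kappa> a_me"
    using assms by (simp add: L_def algebra_simps)
  also have "\<dots> = real (n_gam \<kappa>) * (2 ^ k * K \<kappa> a_me)"
    using n_gam_mult_K[of \<kappa> a_me] kappa by (simp add: mult.left_commute)
  finally have "?q < real (n_gam \<kappa>)" using pos by (simp add: pos_divide_less_eq)
  then have "\<lfloor>?q\<rfloor> < int (n_gam \<kappa>)" by (simp add: floor_less_iff)
  with \<open>0 \<le> ?q\<close> show thesis
    using that[of "nat \<lfloor>?q\<rfloor>"] unfolding mem_Lsub_iff by (auto simp: nat_less_iff)
qed

text \<open>A common point gives \<open>2 ^ i * T < 2 ^ Suc i' * T\<close>, hence
  \<open>i \<le> i'\<close>; the roles of the two levels are then exchanged.\<close>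

lemma L_inj:
  assumes "x \<in> L \<kappa> a_me j" "x \<in> L \<kappa> a_me k"
  shows "j = k"
proof -
  have "i < Suc i'" if "x \<in> L \<kappa> a_me i" "x \<in> L \<kappa> a_me i'" for i i'
  proof -
    have "2 ^ i * T \<kappa> a_me < 2 ^ Suc i' * T \<kappa> a_me"
      using that unfolding L_def by auto
    then have "(2::real) ^ i < 2 ^ Suc i'" using T_pos by (simp only: mult_less_cancel_right_pos)
    then show ?thesis by (subst (asm) power_strict_increasing_iff) simp_all
  qed
  from this[OF assms] this[OF assms(2,1)] show ?thesis by simp
qed

lemma reduced_mem_Lsub:
  assumes "k \<le> \<kappa>" "\<gamma> < n_gam \<kappa>" "a k \<gamma> = Some x"
  shows "prof x \<in> Lsub \<kappa> a_me k \<gamma>"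
  using red assms unfolding is_reduced_def min_size_choice_def is_arg_min_def
  by fastforce

text \<open>Filtering the whole reduced instance by \<open>L\<close> returns one row of the array,
  since the items of row \<open>j\<close> lie in level \<open>j\<close> and the levels are
  disjoint.\<close>

lemma I_level_eq:
  assumes "k \<le> \<kappa>"
  shows "I_level \<kappa> a_me a k = existing \<kappa> a k"
proof -
  have "prof x \<in> L \<kappa> a_me j" if "x \<in> existing \<kappa> a j" "j \<le> \<kappa>" for x j
    using that reduced_mem_Lsub Lsub_subset_L unfolding existing_def by blast
  then show ?thesis
    using assms L_inj unfolding I_level_def I_L_red_def by blast
qed

lemma I_level_Lsub_eq:
  assumes "k \<le> \<kappa>" "\<gamma> < n_gam \<kappa>"
  shows "{z \<in> I_level \<kappa> a_me a k. prof z \<in> Lsub \<kappa> a_me k \<gamma>} = set_option (a k \<gamma>)"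
proof -
  have "\<gamma>' = \<gamma>" if "a k \<gamma>' = Some z" "\<gamma>' < n_gam \<kappa>" "prof z \<in> Lsub \<kappa> a_me k \<gamma>" for z \<gamma>'
    using reduced_mem_Lsub[OF assms(1) that(2,1)] that(3) unfolding mem_Lsub_iff by simp
  then show ?thesis
    using assms reduced_mem_Lsub unfolding I_level_eq[OF assms(1)] existing_def
    by force
qed

text \<open>The candidate set in \<open>is_glued_family\<close>, with the pairs of row
  \<open>k\<close> restricted to \<open>D\<close>. Pairs are recorded by their indices rather than
  by items, so that \<open>D\<close> depends only on the progress of the loops.\<close>

definition candidates ::
  "(nat \<times> nat \<times> nat) set \<Rightarrow> family \<Rightarrow> nat \<Rightarrow> nat \<Rightarrow> item set" where
  "candidates D t k \<gamma> =
     {z \<in> I_level \<kappa> a_me a (k + 1) \<union>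
          {x \<oplus> y | x y. \<exists>g h. (k, g, h) \<in> D \<and> t k g = Some x \<and> t k h = Some y \<and>
                     sz x + sz y \<le> cap}.
        prof z \<in> Lsub \<kappa> a_me (k + 1) \<gamma>}"

definition partially_glued :: "(nat \<times> nat \<times> nat) set \<Rightarrow> family \<Rightarrow> bool" where
  "partially_glued D t \<longleftrightarrow> (\<forall>\<gamma><n_gam \<kappa>. t 0 \<gamma> = a 0 \<gamma>) \<and>
     (\<forall>k<\<kappa>. \<forall>\<gamma><n_gam \<kappa>. min_size_choice (candidates D t k \<gamma>) (t (Suc k) \<gamma>))"

text \<open>Without glued pairs, the only candidate for an entry is the reduced item at that
  position, if any. This is the state after initialisation.\<close>

lemma partially_glued_empty: "partially_glued {} a"
proof -
  have "min_size_choice (candidates {} a k \<gamma>) (a (Suc k) \<gamma>)" if "k < \<kappa>" "\<gamma> < n_gam \<kappa>" for k \<gamma>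
    using I_level_Lsub_eq[of "Suc k" \<gamma>] that
    by (auto simp: candidates_def min_size_choice_def is_arg_min_def split: option.splits)
  then show ?thesis by (simp add: partially_glued_def)
qed

lemma partially_glued_mem_Lsub:
  assumes "partially_glued D t" "k \<le> \<kappa>" "\<gamma> < n_gam \<kappa>" "t k \<gamma> = Some x"
  shows "prof x \<in> Lsub \<kappa> a_me k \<gamma>"
proof (cases k)
  case 0
  then show ?thesis using assms reduced_mem_Lsub[of 0 \<gamma> x] by (simp add: partially_glued_def)
next
  case (Suc j)
  then have "min_size_choice (candidates D t j \<gamma>) (t (Suc j) \<gamma>)"
    using assms(1-3) by (simp add: partially_glued_def)
  then show ?thesis
    using assms(4) Suc by (simp add: min_size_choice_def is_arg_min_def candidates_def)
qed

text \<open>The reason for doubling the levels: two profits in \<open>[2^k T, 2^(k+1) T)\<close>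
  have their sum in \<open>[2^(k+1) T, 2^(k+2) T)\<close>.\<close>

lemma glue_mem_L:
  assumes "partially_glued D t" "k \<le> \<kappa>" "g < n_gam \<kappa>" "h < n_gam \<kappa>"
    "t k g = Some x" "t k h = Some y"
  shows "prof (x \<oplus> y) \<in> L \<kappa> a_me (Suc k)"
proof -
  have "prof x \<in> L \<kappa> a_me k" "prof y \<in> L \<kappa> a_me k"
    using assms partially_glued_mem_Lsub Lsub_subset_L by blast+
  then show ?thesis by (auto simp: L_def glue_def)
qed

section \<open>Effect of one pair on the minimum-size choices\<close>

definition replace :: "family \<Rightarrow> nat \<Rightarrow> nat \<Rightarrow> item \<Rightarrow> family" where
  "replace t k \<gamma> z = t(k := (t k)(\<gamma> := Some z))"

lemma partially_glued_insert_skip: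
  assumes "partially_glued D t"
    and "\<not> (\<exists>x y. t k g = Some x \<and> t k h = Some y \<and> sz x + sz y \<le> cap)"
  shows "partially_glued (insert (k, g, h) D) t"
proof -
  have "(\<exists>g' h'. (j, g', h') \<in> insert (k, g, h) D \<and> t j g' = Some x \<and> t j h' = Some y \<and>
      sz x + sz y \<le> cap) \<longleftrightarrow>
    (\<exists>g' h'. (j, g', h') \<in> D \<and> t j g' = Some x \<and> t j h' = Some y \<and> sz x + sz y \<le> cap)" for j x y
    using assms(2) by blast
  then have "candidates (insert (k, g, h) D) t = candidates D t"
    unfolding candidates_def fun_eq_iff by simp
  then show ?thesis using assms(1) by (simp add: partially_glued_def)
qed

text \<open>The bound on the levels in \<open>D\<close> is essential: a pair of row
  \<open>k + 1\<close> already in \<open>D\<close> would have been formed from items that may be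
  replaced here, and its glued item could cease to be a candidate.\<close>

lemma partially_glued_insert_glue:
  assumes D: "fst ` D \<subseteq> {..k}"
    and t: "partially_glued D t"
    and xy: "t k g = Some x" "t k h = Some y" "sz x + sz y \<le> cap"
    and z: "prof (x \<oplus> y) \<in> Lsub \<kappa> a_me (Suc k) \<gamma>"
  shows "partially_glued (insert (k, g, h) D)
    (if t (Suc k) \<gamma> = None \<or> sz (x \<oplus> y) < sz (the (t (Suc k) \<gamma>))
     then replace t (Suc k) \<gamma> (x \<oplus> y) else t)"
    (is "partially_glued ?D ?t")
proof -
  have row: "?t j \<delta> = (if j = Suc k \<and> \<delta> = \<gamma> \<and>
      (t (Suc k) \<gamma> = None \<or> sz (x \<oplus> y) < sz (the (t (Suc k) \<gamma>)))
      then Some (x \<oplus> y) else t j \<delta>)" for j \<delta>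
    by (simp add: replace_def)
  \<comment> \<open>Rows up to \<open>k\<close> are the same in both families; above
    \<open>k\<close> there are no pairs at all. So the only change is the new pair at
    \<open>j = k\<close>.\<close>
  have pairs: "(\<exists>g' h'. (j, g', h') \<in> ?D \<and> ?t j g' = Some x' \<and> ?t j h' = Some y' \<and>
        sz x' + sz y' \<le> cap) \<longleftrightarrow>
      j = k \<and> x' = x \<and> y' = y \<or>
      (\<exists>g' h'. (j, g', h') \<in> D \<and> t j g' = Some x' \<and> t j h' = Some y' \<and> sz x' + sz y' \<le> cap)"
    for j x' y'
  proof (cases "j \<le> k")
    case True
    then have "?t j = t j" by (simp add: replace_def)
    show ?thesis unfolding \<open>?t j = t j\<close> using xy by auto
  next
    case False
    then show ?thesis using D by auto
  qed
  have Lsub: "prof (x \<oplus> y) \<in> Lsub \<kappa> a_me (k + 1) \<delta> \<longleftrightarrow> \<delta> = \<gamma>" for \<delta>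
    using z unfolding mem_Lsub_iff by auto
  have "w \<in> candidates ?D ?t j \<delta> \<longleftrightarrow>
      w = x \<oplus> y \<and> j = k \<and> prof w \<in> Lsub \<kappa> a_me (j + 1) \<delta> \<or> w \<in> candidates D t j \<delta>" for w j \<delta>
    unfolding candidates_def pairs by blast
  then have cand: "candidates ?D ?t j \<delta> =
      (if j = k \<and> \<delta> = \<gamma> then insert (x \<oplus> y) (candidates D t j \<delta>) else candidates D t j \<delta>)"
    for j \<delta>
    using Lsub by (cases "j = k") (auto simp: set_eq_iff)
  have "min_size_choice (candidates ?D ?t j \<delta>) (?t (Suc j) \<delta>)"
    if "j < \<kappa>" "\<delta> < n_gam \<kappa>" for j \<delta>
  proof -
    have "min_size_choice (candidates D t j \<delta>) (t (Suc j) \<delta>)"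
      using t that by (simp add: partially_glued_def)
    then show ?thesis
      using min_size_choice_insert[of "candidates D t j \<delta>" "t (Suc j) \<delta>" "x \<oplus> y"]
      unfolding cand row by auto
  qed
  moreover have "?t 0 \<delta> = a 0 \<delta>" if "\<delta> < n_gam \<kappa>" for \<delta>
    using t that unfolding row by (simp add: partially_glued_def)
  ultimately show ?thesis by (simp add: partially_glued_def)
qed

section \<open>Progress of the loops, with \<open>(k, g, h)\<close> as the next triple, and the
  final state\<close>

definition processed :: "nat \<Rightarrow> nat \<Rightarrow> nat \<Rightarrow> (nat \<times> nat \<times> nat) set" where
  "processed k g h = {(k', g', h'). k' < \<kappa> \<and> g' \<le> h' \<and> h' < n_gam \<kappa> \<and>
     (k' < k \<or> k' = k \<and> (g' < g \<or> g' = g \<and> h' < h))}"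

lemma processed_empty: "processed 0 0 0 = {}"
  by (auto simp: processed_def)

lemma processed_insert:
  "k < \<kappa> \<Longrightarrow> g \<le> h \<Longrightarrow> h < n_gam \<kappa> \<Longrightarrow>
    insert (k, g, h) (processed k g h) = processed k g (Suc h)"
  by (auto simp: processed_def)

text \<open>The inner loop starts at \<open>h = g\<close>: a triple with first position
  \<open>Suc g\<close> and second below \<open>Suc g\<close> violates \<open>g' \<le> h'\<close>, so
  no pair is missed by starting there.\<close>

lemma processed_next_row: "processed k g (n_gam \<kappa>) = processed k (Suc g) (Suc g)"
  by (auto simp: processed_def)

lemma processed_next_level: "processed k (n_gam \<kappa>) (n_gam \<kappa>) = processed (Suc k) 0 0"
  by (auto simp: processed_def)

lemma is_glued_family_if_partially_glued:
  assumes "partially_glued (processed \<kappa> 0 0) t"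
  shows "is_glued_family \<kappa> a_me a t"
proof -
  have comm: "x \<oplus> y = y \<oplus> x" for x y
    by (simp add: glue_def)
  \<comment> \<open>Every ordered pair is reached up to exchanging its parts. The case
    \<open>g = h\<close> glues two copies of the same item.\<close>
  have ordered: "\<exists>x' y'. x \<oplus> y = x' \<oplus> y' \<and>
      (\<exists>g h. (k, g, h) \<in> processed \<kappa> 0 0 \<and> t k g = Some x' \<and> t k h = Some y' \<and>
        sz x' + sz y' \<le> cap)"
    if k: "k < \<kappa>" and xy: "x \<in> existing \<kappa> t k" "y \<in> existing \<kappa> t k" "sz x + sz y \<le> cap" for k x y
  proof -
    obtain g h where gh: "g < n_gam \<kappa>" "h < n_gam \<kappa>" "t k g = Some x" "t k h = Some y"
      using xy by (auto simp: existing_def)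
    show ?thesis
    proof (cases "g \<le> h")
      case True
      then have "(k, g, h) \<in> processed \<kappa> 0 0"
        using gh k by (simp add: processed_def)
      then show ?thesis using gh xy(3) by blast
    next
      case False
      then have "(k, h, g) \<in> processed \<kappa> 0 0"
        using gh k by (simp add: processed_def)
      moreover have "sz y + sz x \<le> cap" using xy(3) by simp
      ultimately show ?thesis using gh comm by blast
    qed
  qed
  have processed: "t k g = Some x \<Longrightarrow> t k h = Some y \<Longrightarrow> (k, g, h) \<in> processed \<kappa> 0 0 \<Longrightarrow>
      x \<in> existing \<kappa> t k \<and> y \<in> existing \<kappa> t k" for k g h x y
    by (auto simp: processed_def existing_def intro: le_less_trans)
  have glued: "{x \<oplus> y | x y. \<exists>g h. (k, g, h) \<in> processed \<kappa> 0 0 \<and> t k g = Some x \<and> t k h = Some y \<and>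
                     sz x + sz y \<le> cap} =
      {x \<oplus> y | x y. x \<in> existing \<kappa> t k \<and> y \<in> existing \<kappa> t k \<and> sz x + sz y \<le> cap}"
    (is "?A = ?B") if "k < \<kappa>" for k
  proof
    show "?A \<subseteq> ?B" using processed by blast
    show "?B \<subseteq> ?A" using ordered[OF that] by blast
  qed
  have "existing \<kappa> t 0 = existing \<kappa> a 0"
    using assms by (auto simp: existing_def partially_glued_def)
  then show ?thesis
    using assms glued I_level_eq[of 0]
    unfolding is_glued_family_def partially_glued_def candidates_def by simp
qed


section \<open>Correctness of the gluing algorithm\<close>

text \<open>Everything the program may read or write, input arrays included: 16 scalars, and 9
  arrays of \<open>(\<kappa> + 1) * n_gam \<kappa>\<close> entries each. It depends on the
  parameters only, not on the memory.\<close>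

definition cells :: "cell set" where
  "cells = Scalar ` {''eps'', ''P0'', ''kappa'', ''n'', ''T'', ''K'', ''pow'', ''k'', ''g'', ''h'',
       ''i'', ''j'', ''p'', ''s'', ''gam'', ''q''} \<union>
     (\<lambda>(A, i). Slot A i) ` ({''a_ex'', ''a_p'', ''a_s'', ''t_ex'', ''t_p'', ''t_s'',
       ''origin'', ''left'', ''right''} \<times> {..<(\<kappa> + 1) * n_gam \<kappa>})"

lemma finite_cells: "finite cells"
  by (simp add: cells_def)

lemma card_cells_le: "card cells \<le> 16 + 9 * ((\<kappa> + 1) * n_gam \<kappa>)"
proof -
  have "card cells \<le> card (Scalar ` {''eps'', ''P0'', ''kappa'', ''n'', ''T'', ''K'', ''pow'', ''k'',
      ''g'', ''h'', ''i'', ''j'', ''p'', ''s'', ''gam'', ''q''}) +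
    card ((\<lambda>(A, i). Slot A i) ` ({''a_ex'', ''a_p'', ''a_s'', ''t_ex'', ''t_p'', ''t_s'',
       ''origin'', ''left'', ''right''} \<times> {..<(\<kappa> + 1) * n_gam \<kappa>}))"
    unfolding cells_def by (rule card_Un_le)
  also have "\<dots> \<le> 16 + card ({''a_ex'', ''a_p'', ''a_s'', ''t_ex'', ''t_p'', ''t_s'',
       ''origin'', ''left'', ''right''} \<times> {..<(\<kappa> + 1) * n_gam \<kappa>})"
    by (intro add_mono card_image_le order.trans[OF card_image_le]) simp_all
  also have "\<dots> = 16 + 9 * ((\<kappa> + 1) * n_gam \<kappa>)"
    unfolding card_cartesian_product by simp
  finally show ?thesis .
qed

section \<open>Addresses of array positions, and the memory invariant\<close>

lemma idx_less:
  assumes "k \<le> \<kappa>" "\<gamma> < n_gam \<kappa>"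
  shows "idx \<kappa> k \<gamma> < (\<kappa> + 1) * n_gam \<kappa>"
proof -
  have "k * n_gam \<kappa> + \<gamma> < (k + 1) * n_gam \<kappa>" using assms by simp
  also have "\<dots> \<le> (\<kappa> + 1) * n_gam \<kappa>" using assms by (intro mult_right_mono) auto
  finally show ?thesis by (simp add: idx_def)
qed

text \<open>Division with remainder by the row length recovers both indices, so distinct positions
  never share a cell.\<close>

lemma idx_eq_iff:
  assumes "\<gamma> < n_gam \<kappa>" "\<gamma>' < n_gam \<kappa>"
  shows "idx \<kappa> k \<gamma> = idx \<kappa> k' \<gamma>' \<longleftrightarrow> k = k' \<and> \<gamma> = \<gamma>'"
proof
  assume eq: "idx \<kappa> k \<gamma> = idx \<kappa> k' \<gamma>'"
  have "idx \<kappa> k \<gamma> div n_gam \<kappa> = k" "idx \<kappa> k' \<gamma>' div n_gam \<kappa> = k'"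
    "idx \<kappa> k \<gamma> mod n_gam \<kappa> = \<gamma>" "idx \<kappa> k' \<gamma>' mod n_gam \<kappa> = \<gamma>'"
    using assms by (simp_all add: idx_def)
  with eq show "k = k' \<and> \<gamma> = \<gamma>'" by simp
qed simp

lemma real_idx: "real (idx \<kappa> k \<gamma>) = real k * real (n_gam \<kappa>) + real \<gamma>"
  by (simp add: idx_def)

lemma addr_of_nat [simp]: "addr (real n) = n"
  by (simp add: addr_def)

definition stores_parameters :: "memory \<Rightarrow> bool" where
  "stores_parameters m \<longleftrightarrow> m (Scalar ''kappa'') = real \<kappa> \<and> m (Scalar ''n'') = real (n_gam \<kappa>) \<and>
     m (Scalar ''T'') = T \<kappa> a_me \<and> m (Scalar ''K'') = K \<kappa> a_me"

text \<open>In contrast to \<open>stores_backtracking\<close>, the origin of a glued item is required to be a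
  processed triple, so that no row whose items are still being replaced is referred to.\<close>

definition traces :: "(nat \<times> nat \<times> nat) set \<Rightarrow> family \<Rightarrow> memory \<Rightarrow> bool" where
  "traces D t m \<longleftrightarrow>
     (\<forall>k\<le>\<kappa>. \<forall>\<gamma><n_gam \<kappa>. t k \<gamma> \<noteq> None \<longrightarrow>
        m (Slot ''origin'' (idx \<kappa> k \<gamma>)) = 0 \<and> t k \<gamma> = a k \<gamma> \<or>
        m (Slot ''origin'' (idx \<kappa> k \<gamma>)) = 1 \<and>
        (\<exists>j g h x y. k = Suc j \<and> (j, g, h) \<in> D \<and>
           m (Slot ''left'' (idx \<kappa> k \<gamma>)) = real g \<and>
           m (Slot ''right'' (idx \<kappa> k \<gamma>)) = real h \<and>
           t j g = Some x \<and> t j h = Some y \<and>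
           sz x + sz y \<le> cap \<and> t k \<gamma> = Some (x \<oplus> y)))"

text \<open>Quantifying the family inside makes this a predicate on memories alone, which is the
  form required of a loop invariant.\<close>

definition glued_memory :: "(nat \<times> nat \<times> nat) set \<Rightarrow> memory \<Rightarrow> bool" where
  "glued_memory D m \<longleftrightarrow> stores_parameters m \<and>
     (\<exists>t. partially_glued D t \<and> stores_family \<kappa> ''t_ex'' ''t_p'' ''t_s'' t m \<and> traces D t m)"

lemma stores_family_Scalar [simp]:
  "stores_family \<kappa> E P S t (m(Scalar x := v)) = stores_family \<kappa> E P S t m"
  by (simp add: stores_family_def stores_item_def cong: option.case_cong)

lemma traces_Scalar [simp]: "traces D t (m(Scalar x := v)) = traces D t m"
  by (simp add: traces_def)

lemma stores_parameters_Scalar [simp]: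
  "x \<notin> {''kappa'', ''n'', ''T'', ''K''} \<Longrightarrow>
    stores_parameters (m(Scalar x := v)) = stores_parameters m"
  by (auto simp: stores_parameters_def)

lemma glued_memory_Scalar [simp]:
  "x \<notin> {''kappa'', ''n'', ''T'', ''K''} \<Longrightarrow> glued_memory D (m(Scalar x := v)) = glued_memory D m"
  by (simp add: glued_memory_def)

lemma stores_parameters_Slot [simp]:
  "stores_parameters (m(Slot A i := v)) = stores_parameters m"
  by (simp add: stores_parameters_def)

lemma stores_backtracking_if_traces:
  assumes "traces (processed \<kappa> 0 0) t m"
  shows "stores_backtracking \<kappa> a t m"
  unfolding stores_backtracking_def
proof (intro allI impI)
  fix k \<gamma> assume "k \<le> \<kappa>" "\<gamma> < n_gam \<kappa>" "t k \<gamma> \<noteq> None"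
  with assms consider "m (Slot ''origin'' (idx \<kappa> k \<gamma>)) = 0 \<and> t k \<gamma> = a k \<gamma>" |
    j g h x y where "m (Slot ''origin'' (idx \<kappa> k \<gamma>)) = 1"
      "k = Suc j" "(j, g, h) \<in> processed \<kappa> 0 0"
      "m (Slot ''left'' (idx \<kappa> k \<gamma>)) = real g" "m (Slot ''right'' (idx \<kappa> k \<gamma>)) = real h"
      "t j g = Some x" "t j h = Some y" "sz x + sz y \<le> cap" "t k \<gamma> = Some (x \<oplus> y)"
    unfolding traces_def by blast
  then show "m (Slot ''origin'' (idx \<kappa> k \<gamma>)) = 0 \<and> t k \<gamma> = a k \<gamma> \<or>
        m (Slot ''origin'' (idx \<kappa> k \<gamma>)) = 1 \<and> k > 0 \<and>
        (\<exists>g<n_gam \<kappa>. \<exists>h<n_gam \<kappa>. \<exists>x y.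
           m (Slot ''left'' (idx \<kappa> k \<gamma>)) = real g \<and>
           m (Slot ''right'' (idx \<kappa> k \<gamma>)) = real h \<and>
           t (k - 1) g = Some x \<and> t (k - 1) h = Some y \<and>
           sz x + sz y \<le> cap \<and> t k \<gamma> = Some (x \<oplus> y))"
  proof cases
    case 2
    moreover from 2(3) have "g < n_gam \<kappa>" "h < n_gam \<kappa>" by (auto simp: processed_def)
    ultimately show ?thesis
      by (intro disjI2 conjI exI[of _ g] exI[of _ h] exI[of _ x] exI[of _ y]) simp_all
  qed blast
qed

text \<open>All six writes go to the one position \<open>(Suc k, \<gamma>)\<close>. Older traces
  refer to parts in rows up to \<open>k\<close>, which stay as they are, so the recorded pairs
  remain valid.\<close>

lemma glue_update:
  assumes D: "fst ` D \<subseteq> {..k}"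
    and "k < \<kappa>" "\<gamma> < n_gam \<kappa>"
    and xy: "t k g = Some x" "t k h = Some y" "sz x + sz y \<le> cap"
    and fam: "stores_family \<kappa> ''t_ex'' ''t_p'' ''t_s'' t m" and tr: "traces D t m"
    and m': "m' = m(Slot ''t_ex'' (idx \<kappa> (Suc k) \<gamma>) := 1,
        Slot ''t_p'' (idx \<kappa> (Suc k) \<gamma>) := prof x + prof y,
        Slot ''t_s'' (idx \<kappa> (Suc k) \<gamma>) := sz x + sz y,
        Slot ''origin'' (idx \<kappa> (Suc k) \<gamma>) := 1,
        Slot ''left'' (idx \<kappa> (Suc k) \<gamma>) := real g,
        Slot ''right'' (idx \<kappa> (Suc k) \<gamma>) := real h)"
  shows "stores_family \<kappa> ''t_ex'' ''t_p'' ''t_s'' (replace t (Suc k) \<gamma> (x \<oplus> y)) m'"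
    and "traces (insert (k, g, h) D) (replace t (Suc k) \<gamma> (x \<oplus> y)) m'"
proof -
  have same: "m' (Slot A (idx \<kappa> j \<delta>)) = m (Slot A (idx \<kappa> j \<delta>))"
    if "\<delta> < n_gam \<kappa>" "\<not> (j = Suc k \<and> \<delta> = \<gamma>)" for A j \<delta>
    using that \<open>\<gamma> < n_gam \<kappa>\<close> by (auto simp: m' idx_eq_iff)
  show "stores_family \<kappa> ''t_ex'' ''t_p'' ''t_s'' (replace t (Suc k) \<gamma> (x \<oplus> y)) m'"
    unfolding stores_family_def
  proof (intro allI impI)
    fix j \<delta> assume "j \<le> \<kappa>" "\<delta> < n_gam \<kappa>"
    show "stores_item ''t_ex'' ''t_p'' ''t_s'' (idx \<kappa> j \<delta>) (replace t (Suc k) \<gamma> (x \<oplus> y) j \<delta>) m'"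
    proof (cases "j = Suc k \<and> \<delta> = \<gamma>")
      case True
      then show ?thesis by (simp add: stores_item_def replace_def m' glue_def)
    next
      case False
      have "replace t (Suc k) \<gamma> (x \<oplus> y) j \<delta> = t j \<delta>"
        using False by (auto simp: replace_def)
      moreover have "stores_item ''t_ex'' ''t_p'' ''t_s'' (idx \<kappa> j \<delta>) (t j \<delta>) m"
        using fam \<open>j \<le> \<kappa>\<close> \<open>\<delta> < n_gam \<kappa>\<close> by (simp add: stores_family_def)
      ultimately show ?thesis
        using same[OF \<open>\<delta> < n_gam \<kappa>\<close> False] by (simp add: stores_item_def split: option.splits)
    qed
  qed
  show "traces (insert (k, g, h) D) (replace t (Suc k) \<gamma> (x \<oplus> y)) m'"
    unfolding traces_def
  proof (intro allI impI)
    fix j \<delta> assume j: "j \<le> \<kappa>" and \<delta>: "\<delta> < n_gam \<kappa>"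
      and ex: "replace t (Suc k) \<gamma> (x \<oplus> y) j \<delta> \<noteq> None"
    let ?t = "replace t (Suc k) \<gamma> (x \<oplus> y)"
    let ?goal = "m' (Slot ''origin'' (idx \<kappa> j \<delta>)) = 0 \<and> ?t j \<delta> = a j \<delta> \<or>
        m' (Slot ''origin'' (idx \<kappa> j \<delta>)) = 1 \<and>
        (\<exists>i g' h' x' y'. j = Suc i \<and> (i, g', h') \<in> insert (k, g, h) D \<and>
           m' (Slot ''left'' (idx \<kappa> j \<delta>)) = real g' \<and>
           m' (Slot ''right'' (idx \<kappa> j \<delta>)) = real h' \<and>
           ?t i g' = Some x' \<and> ?t i h' = Some y' \<and>
           sz x' + sz y' \<le> cap \<and> ?t j \<delta> = Some (x' \<oplus> y'))"
    show ?goal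
    proof (cases "j = Suc k \<and> \<delta> = \<gamma>")
      case True
      then show ?thesis using xy by (simp add: replace_def m')
    next
      case False
      then have t: "?t j \<delta> = t j \<delta>" by (auto simp: replace_def)
      \<comment> \<open>The parts of an item traced through \<open>D\<close> lie in a row
        \<open>i \<le> k\<close>, never in the row being changed.\<close>
      have lower: "?t i = t i" if "(i, g', h') \<in> D" for i g' h'
        using D that by (force simp: replace_def)
      have "m (Slot ''origin'' (idx \<kappa> j \<delta>)) = 0 \<and> t j \<delta> = a j \<delta> \<or>
        m (Slot ''origin'' (idx \<kappa> j \<delta>)) = 1 \<and>
        (\<exists>i g h x y. j = Suc i \<and> (i, g, h) \<in> D \<and>
           m (Slot ''left'' (idx \<kappa> j \<delta>)) = real g \<and>
           m (Slot ''right'' (idx \<kappa> j \<delta>)) = real h \<and>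
           t i g = Some x \<and> t i h = Some y \<and>
           sz x + sz y \<le> cap \<and> t j \<delta> = Some (x \<oplus> y))"
        using tr j \<delta> ex unfolding traces_def t by blast
      then show ?thesis
        unfolding same[OF \<delta> False] t using lower by (metis insertCI)
    qed
  qed
qed

text \<open>Needed when a pair leaves the memory alone but still counts as processed.\<close>

lemma traces_mono:
  assumes tr: "traces D t m" and sub: "D \<subseteq> D'"
  shows "traces D' t m"
  unfolding traces_def
proof (intro allI impI)
  fix k \<gamma> assume "k \<le> \<kappa>" "\<gamma> < n_gam \<kappa>" "t k \<gamma> \<noteq> None"
  with tr have "m (Slot ''origin'' (idx \<kappa> k \<gamma>)) = 0 \<and> t k \<gamma> = a k \<gamma> \<or>
        m (Slot ''origin'' (idx \<kappa> k \<gamma>)) = 1 \<and>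
        (\<exists>j g h x y. k = Suc j \<and> (j, g, h) \<in> D \<and>
           m (Slot ''left'' (idx \<kappa> k \<gamma>)) = real g \<and>
           m (Slot ''right'' (idx \<kappa> k \<gamma>)) = real h \<and>
           t j g = Some x \<and> t j h = Some y \<and>
           sz x + sz y \<le> cap \<and> t k \<gamma> = Some (x \<oplus> y))"
    unfolding traces_def by blast
  then show "m (Slot ''origin'' (idx \<kappa> k \<gamma>)) = 0 \<and> t k \<gamma> = a k \<gamma> \<or>
        m (Slot ''origin'' (idx \<kappa> k \<gamma>)) = 1 \<and>
        (\<exists>j g h x y. k = Suc j \<and> (j, g, h) \<in> D' \<and>
           m (Slot ''left'' (idx \<kappa> k \<gamma>)) = real g \<and>
           m (Slot ''right'' (idx \<kappa> k \<gamma>)) = real h \<and>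
           t j g = Some x \<and> t j h = Some y \<and>
           sz x + sz y \<le> cap \<and> t k \<gamma> = Some (x \<oplus> y))"
    using sub by blast
qed

lemma Slot_mem_iff: "Slot A i \<in> Scalar ` X \<union> (\<lambda>(A, i). Slot A i) ` (Y \<times> Z) \<longleftrightarrow> A \<in> Y \<and> i \<in> Z"
  by auto

lemma Scalar_mem_iff: "Scalar x \<in> Scalar ` X \<union> (\<lambda>(A, i). Slot A i) ` (Y \<times> Z) \<longleftrightarrow> x \<in> X"
  by auto

lemma Scalar_mem_cells:
  "Scalar x \<in> cells \<longleftrightarrow> x \<in> {''eps'', ''P0'', ''kappa'', ''n'', ''T'', ''K'', ''pow'', ''k'',
      ''g'', ''h'', ''i'', ''j'', ''p'', ''s'', ''gam'', ''q''}"
  unfolding cells_def Scalar_mem_iff ..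

lemma Slot_mem_cells:
  "Slot A i \<in> cells \<longleftrightarrow> A \<in> {''a_ex'', ''a_p'', ''a_s'', ''t_ex'', ''t_p'', ''t_s'',
       ''origin'', ''left'', ''right''} \<and> i < (\<kappa> + 1) * n_gam \<kappa>"
  unfolding cells_def Slot_mem_iff lessThan_iff ..

text \<open>\<open>glued_memory\<close> with its witness \<open>t\<close> made explicit, together
  with the loop variables: the intermediate values inside \<open>glue_pair\<close> can only be
  described through the items of \<open>t\<close>.\<close>

definition pair_state ::
  "(nat \<times> nat \<times> nat) set \<Rightarrow> family \<Rightarrow> nat \<Rightarrow> nat \<Rightarrow> nat \<Rightarrow> memory \<Rightarrow> bool" where
  "pair_state D t k g h m \<longleftrightarrow> stores_parameters m \<and>
     stores_family \<kappa> ''t_ex'' ''t_p'' ''t_s'' t m \<and> traces D t m \<and>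
     m (Scalar ''k'') = real k \<and> m (Scalar ''g'') = real g \<and> m (Scalar ''h'') = real h \<and>
     m (Scalar ''pow'') = 2 ^ Suc k"

lemma pair_state_Scalar [simp]:
  "x \<notin> {''kappa'', ''n'', ''T'', ''K'', ''k'', ''g'', ''h'', ''pow''} \<Longrightarrow>
    pair_state D t k g h (m(Scalar x := v)) = pair_state D t k g h m"
proof -
  assume x: "x \<notin> {''kappa'', ''n'', ''T'', ''K'', ''k'', ''g'', ''h'', ''pow''}"
  then have "''k'' \<noteq> x" "''g'' \<noteq> x" "''h'' \<noteq> x" "''pow'' \<noteq> x" by auto
  with x show ?thesis by (simp add: pair_state_def)
qed

lemma pair_stateD:
  assumes "pair_state D t k g h m"
  shows "m (Scalar ''k'') = real k" "m (Scalar ''g'') = real g" "m (Scalar ''h'') = real h"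
    "m (Scalar ''pow'') = 2 ^ Suc k" "m (Scalar ''n'') = real (n_gam \<kappa>)"
    "m (Scalar ''T'') = T \<kappa> a_me" "m (Scalar ''K'') = K \<kappa> a_me"
  using assms by (simp_all add: pair_state_def stores_parameters_def)

lemma triple_glue_pair_family:
  assumes D: "fst ` D \<subseteq> {..k}"
    and k: "k < \<kappa>" and g: "g < n_gam \<kappa>" and h: "h < n_gam \<kappa>"
    and t: "partially_glued D t"
  shows "triple cells (pair_state D t k g h) glue_pair 200
    (\<lambda>m. glued_memory (insert (k, g, h) D) m \<and> m (Scalar ''k'') = real k \<and>
       m (Scalar ''g'') = real g \<and> m (Scalar ''pow'') = 2 ^ Suc k)"
proof -
  let ?i = "idx \<kappa> k g" and ?j = "idx \<kappa> k h"
  let ?P = "\<lambda>m. pair_state D t k g h m \<and> m (Scalar ''i'') = real ?i \<and> m (Scalar ''j'') = real ?j"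
  let ?Q = "\<lambda>m. glued_memory (insert (k, g, h) D) m \<and> m (Scalar ''k'') = real k \<and>
       m (Scalar ''g'') = real g \<and> m (Scalar ''pow'') = 2 ^ Suc k"
  \<comment> \<open>Stated in the form to which the simplifier brings the bound
    \<open>(\<kappa> + 1) * n_gam \<kappa>\<close> of the array cells.\<close>
  have in_range [simp]: "?i < n_gam \<kappa> + \<kappa> * n_gam \<kappa>" "?j < n_gam \<kappa> + \<kappa> * n_gam \<kappa>"
    using idx_less[of k g] idx_less[of k h] k g h by auto
  have item: "stores_item ''t_ex'' ''t_p'' ''t_s'' (idx \<kappa> j \<delta>) (t j \<delta>) m"
    if "j \<le> \<kappa>" "\<delta> < n_gam \<kappa>" "pair_state D t k g h m" for j \<delta> m
    using that by (simp add: pair_state_def stores_family_def)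
  have i: "triple cells (pair_state D t k g h)
      (''i'' ::= Var ''k'' *\<^sub>e Var ''n'' +\<^sub>e Var ''g'') 6
      (\<lambda>m. pair_state D t k g h m \<and> m (Scalar ''i'') = real ?i)"
    by (rule triple_assign)
      (auto simp: real_idx pair_stateD Scalar_mem_cells)
  have j: "triple cells (\<lambda>m. pair_state D t k g h m \<and> m (Scalar ''i'') = real ?i)
      (''j'' ::= Var ''k'' *\<^sub>e Var ''n'' +\<^sub>e Var ''h'') 6 ?P"
    by (rule triple_assign)
      (auto simp: real_idx pair_stateD Scalar_mem_cells)
  have skip: "glued_memory (insert (k, g, h) D) m"
    if "partially_glued (insert (k, g, h) D) t" "pair_state D t k g h m" for m
    using that traces_mono[of D t m "insert (k, g, h) D"]
    by (auto simp: glued_memory_def pair_state_def)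
  let ?b = "Get ''t_ex'' (Var ''i'') =\<^sub>e Num 1 \<and>\<^sub>e
           Get ''t_ex'' (Var ''j'') =\<^sub>e Num 1 \<and>\<^sub>e
           Get ''t_s'' (Var ''i'') +\<^sub>e Get ''t_s'' (Var ''j'') \<le>\<^sub>e Num cap"
  let ?q = "Get ''t_ex'' (Var ''q'') =\<^sub>e Num 0 \<or>\<^sub>e Var ''s'' <\<^sub>e Get ''t_s'' (Var ''q'')"
  let ?u = "Put ''t_ex'' (Var ''q'') (Num 1) ;;
           Put ''t_p'' (Var ''q'') (Var ''p'') ;;
           Put ''t_s'' (Var ''q'') (Var ''s'') ;;
           Put ''origin'' (Var ''q'') (Num 1) ;;
           Put ''left'' (Var ''q'') (Var ''g'') ;;
           Put ''right'' (Var ''q'') (Var ''h'')"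
  let ?c = "''p'' ::= Get ''t_p'' (Var ''i'') +\<^sub>e Get ''t_p'' (Var ''j'') ;;
        ''s'' ::= Get ''t_s'' (Var ''i'') +\<^sub>e Get ''t_s'' (Var ''j'') ;;
        ''gam'' ::= Floor ((Var ''p'' -\<^sub>e Var ''pow'' *\<^sub>e Var ''T'') /\<^sub>e
                          (Var ''pow'' *\<^sub>e Var ''K'')) ;;
        ''q'' ::= (Var ''k'' +\<^sub>e Num 1) *\<^sub>e Var ''n'' +\<^sub>e Var ''gam'' ;;
        Cond ?q ?u Skip"
  have holds_iff: "holds ?b m \<longleftrightarrow>
      (\<exists>x y. t k g = Some x \<and> t k h = Some y \<and> sz x + sz y \<le> cap)" if "?P m" for m
    using that item[of k g m] item[of k h m] k g h
    by (auto simp: stores_item_def split: option.splits)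
  have test: "test_cells ?b m \<subseteq> cells" if "?P m" for m
    using that by (auto simp: Scalar_mem_cells Slot_mem_cells)
  \<comment> \<open>The case distinction is on \<open>t\<close>, not on the memory, so that
    \<open>x\<close> and \<open>y\<close> are fixed for the whole branch. If no such items exist,
    the precondition is contradictory.\<close>
  have branch: "triple cells (\<lambda>m. ?P m \<and> holds ?b m) ?c 100 ?Q"
  proof (cases "\<exists>x y. t k g = Some x \<and> t k h = Some y \<and> sz x + sz y \<le> cap")
    case False
    then show ?thesis using holds_iff by (intro triple_False) blast
  next
    case True
    then obtain x y where xy: "t k g = Some x" "t k h = Some y" "sz x + sz y \<le> cap" by blast
    have vals: "m (Slot ''t_p'' ?i) = prof x" "m (Slot ''t_p'' ?j) = prof y"
      "m (Slot ''t_s'' ?i) = sz x" "m (Slot ''t_s'' ?j) = sz y" if "pair_state D t k g h m" for m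
      using item[of k g m] item[of k h m] k g h xy that by (simp_all add: stores_item_def)
    have "prof (x \<oplus> y) \<in> L \<kappa> a_me (Suc k)"
      using glue_mem_L[OF t _ g h xy(1,2)] k by simp
    then obtain \<gamma> where \<gamma>: "\<gamma> < n_gam \<kappa>" "prof (x \<oplus> y) \<in> Lsub \<kappa> a_me (Suc k) \<gamma>"
      by (rule ex_Lsub)
    then have gam: "\<lfloor>(prof x + prof y - 2 ^ Suc k * T \<kappa> a_me) / (2 ^ Suc k * K \<kappa> a_me)\<rfloor> = int \<gamma>"
      unfolding mem_Lsub_iff by (simp add: glue_def)
    let ?l = "idx \<kappa> (Suc k) \<gamma>"
    have l [simp]: "?l < n_gam \<kappa> + \<kappa> * n_gam \<kappa>"
      using idx_less[of "Suc k" \<gamma>] k \<gamma> by auto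
    let ?P1 = "\<lambda>m. ?P m \<and> m (Scalar ''p'') = prof x + prof y"
    let ?P2 = "\<lambda>m. pair_state D t k g h m \<and> m (Scalar ''p'') = prof x + prof y \<and>
      m (Scalar ''s'') = sz x + sz y"
    let ?P3 = "\<lambda>m. ?P2 m \<and> m (Scalar ''gam'') = real \<gamma>"
    let ?P4 = "\<lambda>m. ?P2 m \<and> m (Scalar ''q'') = real ?l"
    have p: "triple cells (\<lambda>m. ?P m \<and> holds ?b m)
        (''p'' ::= Get ''t_p'' (Var ''i'') +\<^sub>e Get ''t_p'' (Var ''j'')) 6 ?P1"
      by (rule triple_assign)
        (auto simp: vals Scalar_mem_cells Slot_mem_cells)
    have s: "triple cells ?P1
        (''s'' ::= Get ''t_s'' (Var ''i'') +\<^sub>e Get ''t_s'' (Var ''j'')) 6 ?P2"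
      by (rule triple_assign)
        (auto simp: vals Scalar_mem_cells Slot_mem_cells)
    have gm: "triple cells ?P2
        (''gam'' ::= Floor ((Var ''p'' -\<^sub>e Var ''pow'' *\<^sub>e Var ''T'') /\<^sub>e
                          (Var ''pow'' *\<^sub>e Var ''K''))) 12 ?P3"
      by (rule triple_assign)
        (use gam in \<open>auto simp: pair_stateD Scalar_mem_cells\<close>)
    have q: "triple cells ?P3
        (''q'' ::= (Var ''k'' +\<^sub>e Num 1) *\<^sub>e Var ''n'' +\<^sub>e Var ''gam'') 8 ?P4"
      by (rule triple_assign)
        (auto simp: real_idx pair_stateD Scalar_mem_cells add.commute)
    note step = partially_glued_insert_glue[OF D t xy \<gamma>(2)]
    \<comment> \<open>For a missing item the size cell is unconstrained, but its flag 0 already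
      makes the disjunction true.\<close>
    have better: "holds ?q m \<longleftrightarrow> t (Suc k) \<gamma> = None \<or> sz (x \<oplus> y) < sz (the (t (Suc k) \<gamma>))"
      if "?P4 m" for m
      using item[of "Suc k" \<gamma> m] k \<gamma> that by (auto simp: stores_item_def glue_def split: option.splits)
    have upd: "?Q (m(Slot ''t_ex'' ?l := 1, Slot ''t_p'' ?l := prof x + prof y,
        Slot ''t_s'' ?l := sz x + sz y, Slot ''origin'' ?l := 1, Slot ''left'' ?l := real g,
        Slot ''right'' ?l := real h))" if "?P4 m" "holds ?q m" for m
    proof -
      let ?m = "m(Slot ''t_ex'' ?l := 1, Slot ''t_p'' ?l := prof x + prof y,
        Slot ''t_s'' ?l := sz x + sz y, Slot ''origin'' ?l := 1, Slot ''left'' ?l := real g,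
        Slot ''right'' ?l := real h)"
      have m: "stores_family \<kappa> ''t_ex'' ''t_p'' ''t_s'' t m" "traces D t m" "stores_parameters m"
        using that(1) by (simp_all add: pair_state_def)
      have "partially_glued (insert (k, g, h) D) (replace t (Suc k) \<gamma> (x \<oplus> y))"
        using step better[OF that(1)] that(2) by simp
      moreover have "stores_parameters ?m" using m(3) by simp
      ultimately have "glued_memory (insert (k, g, h) D) ?m"
        using glue_update[OF D k \<gamma>(1) xy m(1,2) refl] unfolding glued_memory_def by blast
      then show ?thesis using that(1) by (auto simp: pair_stateD)
    qed
    \<comment> \<open>The six writes are treated backwards: each precondition is \<open>R\<close>
      with the remaining updates substituted. The constant keeps \<open>?Q\<close> folded, since the
      invariant holds again only after the last write.\<close>
    define R where "R = ?Q"
    let ?V = "\<lambda>m. m (Scalar ''q'') = real ?l \<and> m (Scalar ''p'') = prof x + prof y \<and>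
      m (Scalar ''s'') = sz x + sz y \<and> m (Scalar ''g'') = real g \<and> m (Scalar ''h'') = real h"
    have right: "triple cells (\<lambda>m. ?V m \<and> R (m(Slot ''right'' ?l := real h)))
        (Put ''right'' (Var ''q'') (Var ''h'')) 3 R"
      by (rule triple_put) (simp_all add: Scalar_mem_cells Slot_mem_cells)
    have left: "triple cells
        (\<lambda>m. ?V m \<and> R (m(Slot ''left'' ?l := real g, Slot ''right'' ?l := real h)))
        (Put ''left'' (Var ''q'') (Var ''g'')) 3 (\<lambda>m. ?V m \<and> R (m(Slot ''right'' ?l := real h)))"
      by (rule triple_put) (simp_all add: Scalar_mem_cells Slot_mem_cells)
    have origin: "triple cells
        (\<lambda>m. ?V m \<and> R (m(Slot ''origin'' ?l := 1, Slot ''left'' ?l := real g,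
          Slot ''right'' ?l := real h)))
        (Put ''origin'' (Var ''q'') (Num 1)) 3
        (\<lambda>m. ?V m \<and> R (m(Slot ''left'' ?l := real g, Slot ''right'' ?l := real h)))"
      by (rule triple_put) (simp_all add: Scalar_mem_cells Slot_mem_cells)
    have size: "triple cells
        (\<lambda>m. ?V m \<and> R (m(Slot ''t_s'' ?l := sz x + sz y, Slot ''origin'' ?l := 1,
          Slot ''left'' ?l := real g, Slot ''right'' ?l := real h)))
        (Put ''t_s'' (Var ''q'') (Var ''s'')) 3
        (\<lambda>m. ?V m \<and> R (m(Slot ''origin'' ?l := 1, Slot ''left'' ?l := real g,
          Slot ''right'' ?l := real h)))"
      by (rule triple_put) (simp_all add: Scalar_mem_cells Slot_mem_cells)
    have profit: "triple cells
        (\<lambda>m. ?V m \<and> R (m(Slot ''t_p'' ?l := prof x + prof y, Slot ''t_s'' ?l := sz x + sz y,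
          Slot ''origin'' ?l := 1, Slot ''left'' ?l := real g, Slot ''right'' ?l := real h)))
        (Put ''t_p'' (Var ''q'') (Var ''p'')) 3
        (\<lambda>m. ?V m \<and> R (m(Slot ''t_s'' ?l := sz x + sz y, Slot ''origin'' ?l := 1,
          Slot ''left'' ?l := real g, Slot ''right'' ?l := real h)))"
      by (rule triple_put) (simp_all add: Scalar_mem_cells Slot_mem_cells)
    have flag: "triple cells (\<lambda>m. ?P4 m \<and> holds ?q m)
        (Put ''t_ex'' (Var ''q'') (Num 1)) 3
        (\<lambda>m. ?V m \<and> R (m(Slot ''t_p'' ?l := prof x + prof y, Slot ''t_s'' ?l := sz x + sz y,
          Slot ''origin'' ?l := 1, Slot ''left'' ?l := real g, Slot ''right'' ?l := real h)))"
    proof (rule triple_put)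
      fix m assume m: "?P4 m \<and> holds ?q m"
      from upd m have "R (m(Slot ''t_ex'' ?l := 1, Slot ''t_p'' ?l := prof x + prof y,
          Slot ''t_s'' ?l := sz x + sz y, Slot ''origin'' ?l := 1, Slot ''left'' ?l := real g,
          Slot ''right'' ?l := real h))"
        unfolding R_def by blast
      moreover have "?V m" using m by (auto simp: pair_stateD)
      ultimately show "(?V (m(Slot ''t_ex'' (addr (eval (Var ''q'') m)) := eval (Num 1) m)) \<and>
          R (m(Slot ''t_ex'' (addr (eval (Var ''q'') m)) := eval (Num 1) m,
            Slot ''t_p'' ?l := prof x + prof y, Slot ''t_s'' ?l := sz x + sz y,
            Slot ''origin'' ?l := 1, Slot ''left'' ?l := real g, Slot ''right'' ?l := real h))) \<and>
        insert (Slot ''t_ex'' (addr (eval (Var ''q'') m)))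
          (expr_cells (Var ''q'') m \<union> expr_cells (Num 1) m) \<subseteq> cells"
        by (simp add: Scalar_mem_cells Slot_mem_cells)
    qed simp
    have "triple cells (\<lambda>m. ?P4 m \<and> holds ?q m) ?u 18 R"
      by (rule triple_conseq[OF triple_seq[OF flag triple_seq[OF profit triple_seq[OF size
          triple_seq[OF origin triple_seq[OF left right]]]]]], assumption, simp, assumption)
    then have u: "triple cells (\<lambda>m. ?P4 m \<and> holds ?q m) ?u 18 ?Q"
      by (simp only: R_def)
    have cond: "triple cells ?P4 (Cond ?q ?u Skip) (1 + test_time ?q + 18) ?Q"
    proof (rule triple_cond[OF _ u triple_skip])
      show "test_cells ?q m \<subseteq> cells" if "?P4 m" for m
        using that by (auto simp: Scalar_mem_cells Slot_mem_cells)
      show "?Q m" if "?P4 m \<and> \<not> holds ?q m" for m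
        using that step better[of m] skip[of m] by (auto simp: pair_stateD)
    qed
    show ?thesis
      by (rule triple_conseq[OF triple_seq[OF p triple_seq[OF s triple_seq[OF gm triple_seq[OF q cond]]]]],
          assumption, simp, assumption)
  qed
  have cond: "triple cells ?P (Cond ?b ?c Skip) (1 + test_time ?b + 100) ?Q"
  proof (rule triple_cond[OF test branch triple_skip])
    show "?Q m" if "?P m \<and> \<not> holds ?b m" for m
      using that holds_iff[of m] skip[OF partially_glued_insert_skip[OF t]]
      by (auto simp: pair_stateD)
  qed
  have "triple cells (pair_state D t k g h) glue_pair (6 + (6 + (1 + test_time ?b + 100))) ?Q"
    unfolding glue_pair_def by (rule triple_seq[OF i triple_seq[OF j cond]])
  then show ?thesis
    by (rule triple_conseq) auto
qed

text \<open>The witness family varies with the initial memory, so the triple is unfolded and the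
  witness chosen for each initial configuration.\<close>

lemma triple_glue_pair:
  assumes "fst ` D \<subseteq> {..k}"
    and "k < \<kappa>" "g < n_gam \<kappa>" "h < n_gam \<kappa>"
  shows "triple cells
    (\<lambda>m. glued_memory D m \<and> m (Scalar ''k'') = real k \<and> m (Scalar ''g'') = real g \<and>
       m (Scalar ''h'') = real h \<and> m (Scalar ''pow'') = 2 ^ Suc k)
    glue_pair 200
    (\<lambda>m. glued_memory (insert (k, g, h) D) m \<and> m (Scalar ''k'') = real k \<and>
       m (Scalar ''g'') = real g \<and> m (Scalar ''pow'') = 2 ^ Suc k)"
  unfolding triple_def
proof (intro allI impI, elim conjE)
  fix r :: config
  assume "glued_memory D (mem r)" "mem r (Scalar ''k'') = real k" "mem r (Scalar ''g'') = real g"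
    "mem r (Scalar ''h'') = real h" "mem r (Scalar ''pow'') = 2 ^ Suc k"
  then obtain t where "partially_glued D t" "pair_state D t k g h (mem r)"
    by (auto simp: glued_memory_def pair_state_def)
  with triple_glue_pair_family[of D k g h t, OF assms]
  show "(glued_memory (insert (k, g, h) D) (mem (exec glue_pair r)) \<and>
      mem (exec glue_pair r) (Scalar ''k'') = real k \<and>
      mem (exec glue_pair r) (Scalar ''g'') = real g \<and>
      mem (exec glue_pair r) (Scalar ''pow'') = 2 ^ Suc k) \<and>
    elapsed (exec glue_pair r) \<le> elapsed r + 200 \<and>
    touched (exec glue_pair r) \<subseteq> touched r \<union> cells"
    unfolding triple_def by blast
qed

section \<open>Parameters and initial copy of the reduced instance\<close>

lemma glue_input_Scalar [simp]:
  assumes "x \<notin> {''eps'', ''P0''}"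
  shows "glue_input \<kappa> a_me a (m(Scalar x := v)) = glue_input \<kappa> a_me a m"
proof -
  have "''eps'' \<noteq> x" "''P0'' \<noteq> x" using assms by auto
  then show ?thesis by (simp add: glue_input_def)
qed

lemma triple_glue_setup:
  "triple cells (glue_input \<kappa> a_me a) glue_setup 40
    (\<lambda>m. stores_parameters m \<and> stores_family \<kappa> ''a_ex'' ''a_p'' ''a_s'' a m)"
proof -
  \<comment> \<open>\<open>Log2\<close> is exact and \<open>1 / eps \<kappa>\<close> is a power of
    two, so the scalar \<open>kappa\<close> holds an integer without any rounding.\<close>
  have log: "log 2 (1 / eps \<kappa>) + 1 = real \<kappa>"
    unfolding log_inverse_eps using kappa by (simp add: of_nat_diff)
  have n: "4 / eps \<kappa> * (real \<kappa> + 1) = real (n_gam \<kappa>)"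
    using n_gam_eq kappa by simp
  have input: "m (Scalar ''eps'') = eps \<kappa>" "m (Scalar ''P0'') = P0 a_me"
    if "glue_input \<kappa> a_me a m" for m
    using that by (simp_all add: glue_input_def)
  let ?P1 = "\<lambda>m. glue_input \<kappa> a_me a m \<and> m (Scalar ''kappa'') = real \<kappa>"
  let ?P2 = "\<lambda>m. ?P1 m \<and> m (Scalar ''n'') = real (n_gam \<kappa>)"
  let ?P3 = "\<lambda>m. ?P2 m \<and> m (Scalar ''T'') = T \<kappa> a_me"
  let ?P4 = "\<lambda>m. ?P3 m \<and> m (Scalar ''K'') = K \<kappa> a_me"
  have 1: "triple cells (glue_input \<kappa> a_me a)
      (''kappa'' ::= Log2 (Num 1 /\<^sub>e Var ''eps'') +\<^sub>e Num 1) 7 ?P1"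
    by (rule triple_assign) (use log in \<open>simp_all add: input Scalar_mem_cells\<close>)
  have 2: "triple cells ?P1 (''n'' ::= Num 4 /\<^sub>e Var ''eps'' *\<^sub>e (Var ''kappa'' +\<^sub>e Num 1)) 8 ?P2"
    by (rule triple_assign) (use n in \<open>auto simp: input Scalar_mem_cells\<close>)
  have 3: "triple cells ?P2 (''T'' ::= Num (1/2) *\<^sub>e Var ''eps'' *\<^sub>e Var ''P0'') 6 ?P3"
    by (rule triple_assign) (auto simp: input Scalar_mem_cells T_def)
  have 4: "triple cells ?P3 (''K'' ::= Num (1/4) *\<^sub>e (Num 1 /\<^sub>e (Var ''kappa'' +\<^sub>e Num 1)) *\<^sub>e
      Var ''eps'' *\<^sub>e Var ''T'') 12 ?P4"
    by (rule triple_assign) (auto simp: input Scalar_mem_cells K_def)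
  have "triple cells (glue_input \<kappa> a_me a) glue_setup (7 + (8 + (6 + 12))) ?P4"
    unfolding glue_setup_def by (rule triple_seq[OF 1 triple_seq[OF 2 triple_seq[OF 3 4]]])
  then show ?thesis
    by (rule triple_conseq) (auto simp: stores_parameters_def glue_input_def)
qed

lemma stores_family_Slot:
  assumes "A \<notin> {E, P, S}"
  shows "stores_family \<kappa> E P S t (m(Slot A i := v)) = stores_family \<kappa> E P S t m"
proof -
  have "E \<noteq> A" "P \<noteq> A" "S \<noteq> A" using assms by auto
  then show ?thesis
    by (simp add: stores_family_def stores_item_def cong: option.case_cong)
qed

text \<open>Progress is counted by the linear address \<open>r\<close>. The end of one row is then
  the start of the next, and both loops share this invariant.\<close>

definition copied :: "nat \<Rightarrow> memory \<Rightarrow> bool" where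
  "copied r m \<longleftrightarrow> stores_parameters m \<and> stores_family \<kappa> ''a_ex'' ''a_p'' ''a_s'' a m \<and>
     (\<forall>i<r. m (Slot ''t_ex'' i) = m (Slot ''a_ex'' i) \<and> m (Slot ''t_p'' i) = m (Slot ''a_p'' i) \<and>
        m (Slot ''t_s'' i) = m (Slot ''a_s'' i) \<and> m (Slot ''origin'' i) = 0)"

lemma copied_Scalar [simp]:
  "x \<notin> {''kappa'', ''n'', ''T'', ''K''} \<Longrightarrow> copied r (m(Scalar x := v)) = copied r m"
  by (simp add: copied_def)

lemma copied_Slot [simp]:
  assumes "A \<in> {''t_ex'', ''t_p'', ''t_s'', ''origin''}"
  shows "copied r (m(Slot A r := v)) = copied r m"
proof -
  have "A \<notin> {''a_ex'', ''a_p'', ''a_s''}" using assms by auto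
  moreover from this have "''a_ex'' \<noteq> A" "''a_p'' \<noteq> A" "''a_s'' \<noteq> A" by auto
  ultimately show ?thesis by (simp add: copied_def stores_family_Slot cong: conj_cong)
qed

lemma copied_Suc:
  "copied r m \<Longrightarrow> m (Slot ''t_ex'' r) = m (Slot ''a_ex'' r) \<Longrightarrow>
    m (Slot ''t_p'' r) = m (Slot ''a_p'' r) \<Longrightarrow> m (Slot ''t_s'' r) = m (Slot ''a_s'' r) \<Longrightarrow>
    m (Slot ''origin'' r) = 0 \<Longrightarrow> copied (Suc r) m"
  by (simp add: copied_def less_Suc_eq all_conj_distrib)

lemma copiedD:
  assumes "copied r m"
  shows "m (Scalar ''kappa'') = real \<kappa>" "m (Scalar ''n'') = real (n_gam \<kappa>)"
  using assms by (simp_all add: copied_def stores_parameters_def)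

lemma glued_memory_if_copied:
  assumes "copied ((\<kappa> + 1) * n_gam \<kappa>) m"
  shows "glued_memory {} m"
proof -
  have row: "m (Slot ''t_ex'' (idx \<kappa> k \<gamma>)) = m (Slot ''a_ex'' (idx \<kappa> k \<gamma>))"
    "m (Slot ''t_p'' (idx \<kappa> k \<gamma>)) = m (Slot ''a_p'' (idx \<kappa> k \<gamma>))"
    "m (Slot ''t_s'' (idx \<kappa> k \<gamma>)) = m (Slot ''a_s'' (idx \<kappa> k \<gamma>))"
    "m (Slot ''origin'' (idx \<kappa> k \<gamma>)) = 0" if "k \<le> \<kappa>" "\<gamma> < n_gam \<kappa>" for k \<gamma>
    using assms idx_less[OF that] unfolding copied_def by blast+
  have "stores_family \<kappa> ''t_ex'' ''t_p'' ''t_s'' a m"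
    using assms row by (simp add: copied_def stores_family_def stores_item_def cong: option.case_cong)
  moreover have "traces {} a m"
    using row by (simp add: traces_def)
  ultimately show ?thesis
    using assms partially_glued_empty by (auto simp: glued_memory_def copied_def)
qed

lemma triple_glue_init:
  "triple cells
    (\<lambda>m. stores_parameters m \<and> stores_family \<kappa> ''a_ex'' ''a_p'' ''a_s'' a m)
    glue_init (3 + 28 * ((\<kappa> + 1) * n_gam \<kappa>)) (glued_memory {})"
proof -
  let ?N = "n_gam \<kappa>"
  have body: "triple cells
    (\<lambda>m. m (Scalar ''g'') = real g \<and> m (Scalar ''k'') = real k \<and> copied (idx \<kappa> k g) m)
    (''i'' ::= Var ''k'' *\<^sub>e Var ''n'' +\<^sub>e Var ''g'' ;;
          Put ''t_ex'' (Var ''i'') (Get ''a_ex'' (Var ''i'')) ;;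
          Put ''t_p'' (Var ''i'') (Get ''a_p'' (Var ''i'')) ;;
          Put ''t_s'' (Var ''i'') (Get ''a_s'' (Var ''i'')) ;;
          Put ''origin'' (Var ''i'') (Num 0)) 21
    (\<lambda>m. m (Scalar ''k'') = real k \<and> copied (Suc (idx \<kappa> k g)) m)"
    if k: "k \<le> \<kappa>" and g: "g < n_gam \<kappa>" for k g
  proof -
    let ?r = "idx \<kappa> k g"
    have [simp]: "?r < n_gam \<kappa> + \<kappa> * n_gam \<kappa>" using idx_less[OF k g] by simp
    let ?P = "\<lambda>m. m (Scalar ''k'') = real k \<and> m (Scalar ''i'') = real ?r \<and> copied ?r m"
    let ?P1 = "\<lambda>m. ?P m \<and> m (Slot ''t_ex'' ?r) = m (Slot ''a_ex'' ?r)"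
    let ?P2 = "\<lambda>m. ?P1 m \<and> m (Slot ''t_p'' ?r) = m (Slot ''a_p'' ?r)"
    let ?P3 = "\<lambda>m. ?P2 m \<and> m (Slot ''t_s'' ?r) = m (Slot ''a_s'' ?r)"
    have i: "triple cells
      (\<lambda>m. m (Scalar ''g'') = real g \<and> m (Scalar ''k'') = real k \<and> copied ?r m)
      (''i'' ::= Var ''k'' *\<^sub>e Var ''n'' +\<^sub>e Var ''g'') 6 ?P"
      by (rule triple_assign) (auto simp: real_idx copiedD Scalar_mem_cells)
    have 1: "triple cells ?P (Put ''t_ex'' (Var ''i'') (Get ''a_ex'' (Var ''i''))) 4 ?P1"
      by (rule triple_put) (simp_all add: Scalar_mem_cells Slot_mem_cells)
    have 2: "triple cells ?P1 (Put ''t_p'' (Var ''i'') (Get ''a_p'' (Var ''i''))) 4 ?P2"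
      by (rule triple_put) (simp_all add: Scalar_mem_cells Slot_mem_cells)
    have 3: "triple cells ?P2 (Put ''t_s'' (Var ''i'') (Get ''a_s'' (Var ''i''))) 4 ?P3"
      by (rule triple_put) (simp_all add: Scalar_mem_cells Slot_mem_cells)
    have 4: "triple cells ?P3 (Put ''origin'' (Var ''i'') (Num 0)) 3
        (\<lambda>m. m (Scalar ''k'') = real k \<and> copied (Suc ?r) m)"
      by (rule triple_put) (auto simp: Scalar_mem_cells Slot_mem_cells intro!: copied_Suc)
    show ?thesis
      by (rule triple_conseq[OF triple_seq[OF i triple_seq[OF 1 triple_seq[OF 2
          triple_seq[OF 3 4]]]]], assumption, simp, assumption)
  qed
  have row: "triple cells (\<lambda>m. m (Scalar ''k'') = real k \<and> copied (k * ?N) m)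
      (For ''g'' (Num 0) (Var ''n'' -\<^sub>e Num 1)
         (''i'' ::= Var ''k'' *\<^sub>e Var ''n'' +\<^sub>e Var ''g'' ;;
          Put ''t_ex'' (Var ''i'') (Get ''a_ex'' (Var ''i'')) ;;
          Put ''t_p'' (Var ''i'') (Get ''a_p'' (Var ''i'')) ;;
          Put ''t_s'' (Var ''i'') (Get ''a_s'' (Var ''i'')) ;;
          Put ''origin'' (Var ''i'') (Num 0)))
      (27 * ?N) (\<lambda>m. copied (Suc k * ?N) m)" if k: "k \<le> \<kappa>" for k
  proof (rule triple_conseq[OF triple_for[where l = 0 and u = "?N" and \<tau> = 21 and
        Inv = "\<lambda>g m. m (Scalar ''k'') = real k \<and> copied (k * ?N + g) m" and
        P = "\<lambda>m. m (Scalar ''k'') = real k \<and> copied (k * ?N) m" and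
        Q = "\<lambda>m. copied (Suc k * ?N) m"]])
    show "triple cells
      (\<lambda>m. m (Scalar ''g'') = real g \<and> m (Scalar ''k'') = real k \<and> copied (k * ?N + g) m)
      (''i'' ::= Var ''k'' *\<^sub>e Var ''n'' +\<^sub>e Var ''g'' ;;
          Put ''t_ex'' (Var ''i'') (Get ''a_ex'' (Var ''i'')) ;;
          Put ''t_p'' (Var ''i'') (Get ''a_p'' (Var ''i'')) ;;
          Put ''t_s'' (Var ''i'') (Get ''a_s'' (Var ''i'')) ;;
          Put ''origin'' (Var ''i'') (Num 0)) 21
      (\<lambda>m. m (Scalar ''k'') = real k \<and> copied (k * ?N + Suc g) m)" if "g < ?N" for g
      using body[OF k that] by (simp add: idx_def)
    show "1 + expr_time (Num 0) + expr_time (Var ''n'' -\<^sub>e Num 1) + (?N - 0) * (1 + 21) \<le> 27 * ?N"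
      using n_gam_pos[of \<kappa>] by simp
  qed (auto simp: copiedD Scalar_mem_cells add.commute)
  show ?thesis
    unfolding glue_init_def
  proof (rule triple_conseq[OF triple_for[where l = 0 and u = "\<kappa> + 1" and \<tau> = "27 * ?N" and
        Inv = "\<lambda>k m. copied (k * ?N) m" and Q = "glued_memory {}" and P = "copied 0"]])
    show "triple cells (\<lambda>m. m (Scalar ''k'') = real k \<and> copied (k * ?N) m)
      (For ''g'' (Num 0) (Var ''n'' -\<^sub>e Num 1)
         (''i'' ::= Var ''k'' *\<^sub>e Var ''n'' +\<^sub>e Var ''g'' ;;
          Put ''t_ex'' (Var ''i'') (Get ''a_ex'' (Var ''i'')) ;;
          Put ''t_p'' (Var ''i'') (Get ''a_p'' (Var ''i'')) ;;
          Put ''t_s'' (Var ''i'') (Get ''a_s'' (Var ''i'')) ;;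
          Put ''origin'' (Var ''i'') (Num 0)))
      (27 * ?N) (copied (Suc k * ?N))" if "k < \<kappa> + 1" for k
      using row[of k] that by simp
    \<comment> \<open>Each entry costs 22, the bounds of the inner loop 5 and the outer iteration 1;
      as \<open>?N\<close> is positive, all of it fits into \<open>28 * ?N\<close> per row.\<close>
    have "(\<kappa> + 1) * (1 + 27 * ?N) \<le> (\<kappa> + 1) * (28 * ?N)"
      using n_gam_pos[of \<kappa>] by (intro mult_left_mono) auto
    then show "1 + expr_time (Num 0) + expr_time (Var ''kappa'') +
        (\<kappa> + 1 - 0) * (1 + 27 * ?N) \<le> 3 + 28 * ((\<kappa> + 1) * ?N)"
      by simp
    show "glued_memory {} m" if "copied ((\<kappa> + 1) * ?N) m" for m
      using glued_memory_if_copied that .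
  qed (auto simp: copied_def stores_parameters_def Scalar_mem_cells)
qed

section \<open>Nesting of the loops and the total running time\<close>

lemma glued_memoryD:
  assumes "glued_memory D m"
  shows "m (Scalar ''kappa'') = real \<kappa>" "m (Scalar ''n'') = real (n_gam \<kappa>)"
  using assms by (simp_all add: glued_memory_def stores_parameters_def)

lemma fst_processed: "fst ` processed k g h \<subseteq> {..k}"
  by (auto simp: processed_def)

lemma triple_glue_row:
  assumes k: "k < \<kappa>"
  shows "triple cells
    (\<lambda>m. glued_memory (processed k 0 0) m \<and> m (Scalar ''k'') = real k \<and>
       m (Scalar ''pow'') = 2 ^ Suc k)
    (For ''g'' (Num 0) (Var ''n'' -\<^sub>e Num 1)
       (For ''h'' (Var ''g'') (Var ''n'' -\<^sub>e Num 1) glue_pair))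
    (212 * (n_gam \<kappa> * n_gam \<kappa>))
    (\<lambda>m. glued_memory (processed (Suc k) 0 0) m \<and> m (Scalar ''pow'') = 2 ^ Suc k)"
proof -
  let ?N = "n_gam \<kappa>"
  let ?I = "\<lambda>g m. glued_memory (processed k g g) m \<and> m (Scalar ''k'') = real k \<and>
    m (Scalar ''pow'') = 2 ^ Suc k"
  have row: "triple cells (\<lambda>m. m (Scalar ''g'') = real g \<and> ?I g m)
      (For ''h'' (Var ''g'') (Var ''n'' -\<^sub>e Num 1) glue_pair) (206 * ?N) (?I (Suc g))"
    if g: "g < ?N" for g
  proof (rule triple_conseq[OF triple_for[where l = g and u = "?N" and \<tau> = 200 and Q = "?I (Suc g)" and
        P = "\<lambda>m. m (Scalar ''g'') = real g \<and> ?I g m" and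
        Inv = "\<lambda>h m. glued_memory (processed k g h) m \<and> m (Scalar ''k'') = real k \<and>
          m (Scalar ''g'') = real g \<and> m (Scalar ''pow'') = 2 ^ Suc k"]])
    show "triple cells
      (\<lambda>m. m (Scalar ''h'') = real h \<and> glued_memory (processed k g h) m \<and>
        m (Scalar ''k'') = real k \<and> m (Scalar ''g'') = real g \<and> m (Scalar ''pow'') = 2 ^ Suc k)
      glue_pair 200
      (\<lambda>m. glued_memory (processed k g (Suc h)) m \<and> m (Scalar ''k'') = real k \<and>
        m (Scalar ''g'') = real g \<and> m (Scalar ''pow'') = 2 ^ Suc k)" if "g \<le> h" "h < ?N" for h
      by (rule triple_conseq[OF triple_glue_pair[OF fst_processed k g that(2)]])
        (use processed_insert[OF k that] in auto)
    show "1 + expr_time (Var ''g'') + expr_time (Var ''n'' -\<^sub>e Num 1) + (?N - g) * (1 + 200)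
        \<le> 206 * ?N"
      using g by simp
  qed (use g in \<open>auto simp: glued_memoryD Scalar_mem_cells processed_next_row\<close>)
  show ?thesis
  proof (rule triple_conseq[OF triple_for[where l = 0 and u = "?N" and \<tau> = "206 * ?N" and Inv = ?I and
        P = "?I 0" and Q = "\<lambda>m. glued_memory (processed (Suc k) 0 0) m \<and> m (Scalar ''pow'') = 2 ^ Suc k"]])
    show "triple cells (\<lambda>m. m (Scalar ''g'') = real g \<and> ?I g m)
      (For ''h'' (Var ''g'') (Var ''n'' -\<^sub>e Num 1) glue_pair) (206 * ?N) (?I (Suc g))"
      if "g < ?N" for g
      using row that .
    \<comment> \<open>The lower-order terms \<open>5 + ?N\<close> are absorbed:
      \<open>206 + 1 + 5 = 212\<close>.\<close>
    have "?N \<le> ?N * ?N" "1 \<le> ?N * ?N" using n_gam_pos[of \<kappa>] by simp_all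
    moreover have "?N * (1 + 206 * ?N) = ?N + 206 * (?N * ?N)" by (simp add: algebra_simps)
    ultimately show "1 + expr_time (Num 0) + expr_time (Var ''n'' -\<^sub>e Num 1) +
        (?N - 0) * (1 + 206 * ?N) \<le> 212 * (?N * ?N)"
      unfolding expr_time.simps diff_zero by linarith
  qed (auto simp: glued_memoryD Scalar_mem_cells processed_next_level)
qed

lemma triple_glue_alg:
  "triple cells (glue_input \<kappa> a_me a) glue_alg
    (300 * ((\<kappa> + 1) * n_gam \<kappa> * n_gam \<kappa>)) (glued_memory (processed \<kappa> 0 0))"
proof -
  let ?N = "n_gam \<kappa>"
  \<comment> \<open>On entry \<open>pow\<close> is still \<open>2 ^ k\<close>; the body doubles it
    first, so that it fits level \<open>k + 1\<close> while pairs of row \<open>k\<close> are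
    glued.\<close>
  let ?I = "\<lambda>k m. glued_memory (processed k 0 0) m \<and> m (Scalar ''pow'') = 2 ^ k"
  let ?row = "For ''g'' (Num 0) (Var ''n'' -\<^sub>e Num 1)
       (For ''h'' (Var ''g'') (Var ''n'' -\<^sub>e Num 1) glue_pair)"
  have pow: "triple cells (glued_memory {}) (''pow'' ::= Num 1) 2 (?I 0)"
    by (rule triple_assign) (simp_all add: Scalar_mem_cells processed_empty)
  have body: "triple cells (\<lambda>m. m (Scalar ''k'') = real k \<and> ?I k m)
      (''pow'' ::= Num 2 *\<^sub>e Var ''pow'' ;; ?row) (4 + 212 * (?N * ?N)) (?I (Suc k))"
    if "k < \<kappa>" for k
    by (rule triple_seq[OF triple_assign triple_glue_row[OF that]])
      (simp_all add: Scalar_mem_cells)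
  have main: "triple cells (?I 0)
      (For ''k'' (Num 0) (Var ''kappa'' -\<^sub>e Num 1) (''pow'' ::= Num 2 *\<^sub>e Var ''pow'' ;; ?row))
      (5 + \<kappa> * (5 + 212 * (?N * ?N))) (glued_memory (processed \<kappa> 0 0))"
  proof (rule triple_conseq[OF triple_for[where l = 0 and u = \<kappa> and \<tau> = "4 + 212 * (?N * ?N)" and
        Inv = ?I and P = "?I 0" and Q = "glued_memory (processed \<kappa> 0 0)"]])
    show "triple cells (\<lambda>m. m (Scalar ''k'') = real k \<and> ?I k m)
      (''pow'' ::= Num 2 *\<^sub>e Var ''pow'' ;; ?row) (4 + 212 * (?N * ?N)) (?I (Suc k))"
      if "k < \<kappa>" for k
      using body that .
  qed (auto simp: glued_memoryD Scalar_mem_cells)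
  have triple: "triple cells (glue_input \<kappa> a_me a) glue_alg
      (40 + (3 + 28 * ((\<kappa> + 1) * ?N) + (2 + (5 + \<kappa> * (5 + 212 * (?N * ?N))))))
      (glued_memory (processed \<kappa> 0 0))"
    unfolding glue_alg_def
    by (rule triple_seq[OF triple_glue_setup triple_seq[OF triple_glue_init triple_seq[OF pow main]]])
  have time: "40 + (3 + 28 * ((\<kappa> + 1) * ?N) + (2 + (5 + \<kappa> * (5 + 212 * (?N * ?N)))))
      \<le> 300 * ((\<kappa> + 1) * ?N * ?N)"
  proof -
    \<comment> \<open>Each summand is a multiple of \<open>c\<close>: the constants give 50, the
      initialisation 28 and the main loop 217, in total 295.\<close>
    define c where "c = (\<kappa> + 1) * ?N * ?N"
    have "1 \<le> c" using n_gam_pos[of \<kappa>] by (simp add: c_def)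
    moreover have "(\<kappa> + 1) * ?N \<le> c" using n_gam_pos[of \<kappa>] by (simp add: c_def)
    moreover have "\<kappa> * (5 + 212 * (?N * ?N)) \<le> 217 * c"
    proof -
      have "5 + 212 * (?N * ?N) \<le> 217 * (?N * ?N)" using n_gam_pos[of \<kappa>] by simp
      then have "\<kappa> * (5 + 212 * (?N * ?N)) \<le> (\<kappa> + 1) * (217 * (?N * ?N))"
        by (intro mult_mono) auto
      then show ?thesis by (simp add: c_def algebra_simps)
    qed
    ultimately show ?thesis unfolding c_def[symmetric] by linarith
  qed
  show ?thesis by (rule triple_conseq[OF triple _ time])
qed

lemma glue_alg_correct:
  assumes "glue_input \<kappa> a_me a m"
  shows "\<exists>t. is_glued_family \<kappa> a_me a t \<and>
      stores_family \<kappa> ''t_ex'' ''t_p'' ''t_s'' t (mem (run glue_alg m)) \<and>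
      stores_backtracking \<kappa> a t (mem (run glue_alg m))"
    and "elapsed (run glue_alg m) \<le> 300 * ((\<kappa> + 1) * n_gam \<kappa> * n_gam \<kappa>)"
    and "finite (touched (run glue_alg m))"
    and "card (touched (run glue_alg m)) \<le> 16 + 9 * ((\<kappa> + 1) * n_gam \<kappa>)"
proof -
  let ?r = "\<lparr>mem = m, elapsed = 0, touched = {}\<rparr>"
  have *: "glued_memory (processed \<kappa> 0 0) (mem (run glue_alg m)) \<and>
      elapsed (run glue_alg m) \<le> 300 * ((\<kappa> + 1) * n_gam \<kappa> * n_gam \<kappa>) \<and>
      touched (run glue_alg m) \<subseteq> cells"
    using triple_glue_alg[unfolded triple_def, rule_format, of ?r] assms by (simp add: run_def)
  then show "\<exists>t. is_glued_family \<kappa> a_me a t \<and>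
      stores_family \<kappa> ''t_ex'' ''t_p'' ''t_s'' t (mem (run glue_alg m)) \<and>
      stores_backtracking \<kappa> a t (mem (run glue_alg m))"
    using is_glued_family_if_partially_glued stores_backtracking_if_traces
    unfolding glued_memory_def by blast
  show "elapsed (run glue_alg m) \<le> 300 * ((\<kappa> + 1) * n_gam \<kappa> * n_gam \<kappa>)" using * by blast
  show "finite (touched (run glue_alg m))" using * finite_cells finite_subset by blast
  have "card (touched (run glue_alg m)) \<le> card cells" using * finite_cells card_mono by blast
  then show "card (touched (run glue_alg m)) \<le> 16 + 9 * ((\<kappa> + 1) * n_gam \<kappa>)"
    using card_cells_le by linarith
qed

end


section \<open>The item \<open>a_eff_c\<close>\<close>

text \<open>The machine rounds only downwards, so the ceiling is computed as minus the floor of the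
  negated quotient. There is no loop, so the time is constant.\<close>

definition eff_alg :: com where
  "eff_alg =
     ''m'' ::= Num 0 -\<^sub>e Floor (Num 0 -\<^sub>e Var ''P0'' /\<^sub>e Num 4 /\<^sub>e Var ''p_eff'') ;;
     Cond (Var ''m'' *\<^sub>e Var ''s_eff'' \<le>\<^sub>e Num cap)
       (Put ''c_ex'' (Num 0) (Num 1) ;;
        Put ''c_p'' (Num 0) (Var ''m'' *\<^sub>e Var ''p_eff'') ;;
        Put ''c_s'' (Num 0) (Var ''m'' *\<^sub>e Var ''s_eff''))
       (Put ''c_ex'' (Num 0) (Num 0))"

lemma eff_alg_correct:
  assumes "eff_input a_me a_eff m"
  shows "stores_item ''c_ex'' ''c_p'' ''c_s'' 0 (a_eff_c a_me a_eff) (mem (run eff_alg m))"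
    and "elapsed (run eff_alg m) \<le> 50"
proof -
  have [simp]: "m (Scalar ''P0'') = P0 a_me" "m (Scalar ''p_eff'') = prof a_eff"
    "m (Scalar ''s_eff'') = sz a_eff"
    using assms by (simp_all add: eff_input_def)
  have "addr 0 = 0" by (simp add: addr_def)
  then show "stores_item ''c_ex'' ''c_p'' ''c_s'' 0 (a_eff_c a_me a_eff) (mem (run eff_alg m))"
    by (simp add: eff_alg_def run_def store_def charge_def Let_def stores_item_def a_eff_c_def
        ceiling_def)
  show "elapsed (run eff_alg m) \<le> 50"
    by (simp add: eff_alg_def run_def store_def charge_def Let_def)
qed

theorem theorem7:
  shows
    "(\<exists>C>0. \<forall>\<kappa> I a_me a t.
        ukp_instance I \<longrightarrow> eps \<kappa> \<le> 1/4 \<longrightarrow> most_efficient I a_me \<longrightarrow>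
        is_reduced \<kappa> I a_me a \<longrightarrow> is_glued_family \<kappa> a_me a t \<longrightarrow>
          (\<forall>k\<le>\<kappa>. finite (existing \<kappa> t k) \<and>
             real (card (existing \<kappa> t k)) \<le> C * (1 / eps \<kappa> * log 2 (1 / eps \<kappa>))) \<and>
          finite (G \<kappa> t) \<and>
          real (card (G \<kappa> t)) \<le> C * (1 / eps \<kappa> * (log 2 (1 / eps \<kappa>))\<^sup>2))
     \<and>
     (\<exists>C>0. \<forall>\<kappa> I a_me a m.
        ukp_instance I \<longrightarrow> eps \<kappa> \<le> 1/4 \<longrightarrow> most_efficient I a_me \<longrightarrow>
        is_reduced \<kappa> I a_me a \<longrightarrow> glue_input \<kappa> a_me a m \<longrightarrow>
          (\<exists>t. is_glued_family \<kappa> a_me a t \<and>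
             stores_family \<kappa> ''t_ex'' ''t_p'' ''t_s'' t (mem (run glue_alg m)) \<and>
             stores_backtracking \<kappa> a t (mem (run glue_alg m))) \<and>
          real (elapsed (run glue_alg m)) \<le> C * (1 / (eps \<kappa>)\<^sup>2 * (log 2 (1 / eps \<kappa>)) ^ 3) \<and>
          finite (touched (run glue_alg m)) \<and>
          real (card (touched (run glue_alg m))) \<le> C * (1 / eps \<kappa> * (log 2 (1 / eps \<kappa>))\<^sup>2))
     \<and>
     (\<exists>prog C. \<forall>\<kappa> I a_me a_eff m.
        ukp_instance I \<longrightarrow> eps \<kappa> \<le> 1/4 \<longrightarrow> most_efficient I a_me \<longrightarrow>
        most_efficient (I_S \<kappa> I a_me) a_eff \<longrightarrow> eff_input a_me a_eff m \<longrightarrow>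
          stores_item ''c_ex'' ''c_p'' ''c_s'' 0 (a_eff_c a_me a_eff) (mem (run prog m)) \<and>
          elapsed (run prog m) \<le> C)"
proof (intro conjI)
  show "\<exists>C>0. \<forall>\<kappa> I a_me a t.
        ukp_instance I \<longrightarrow> eps \<kappa> \<le> 1/4 \<longrightarrow> most_efficient I a_me \<longrightarrow>
        is_reduced \<kappa> I a_me a \<longrightarrow> is_glued_family \<kappa> a_me a t \<longrightarrow>
          (\<forall>k\<le>\<kappa>. finite (existing \<kappa> t k) \<and>
             real (card (existing \<kappa> t k)) \<le> C * (1 / eps \<kappa> * log 2 (1 / eps \<kappa>))) \<and>
          finite (G \<kappa> t) \<and>
          real (card (G \<kappa> t)) \<le> C * (1 / eps \<kappa> * (log 2 (1 / eps \<kappa>))\<^sup>2)"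
  \<comment> \<open>One constant serves both bounds: 8 suffices for a single row, 16 is needed by
    the estimate for all rows.\<close>
  proof (rule exI[of _ 16], intro conjI allI impI)
    fix \<kappa> k :: nat and t :: family
    assume "eps \<kappa> \<le> 1/4"
    then have \<kappa>: "3 \<le> \<kappa>" by (simp only: eps_le_quarter_iff)
    have "0 \<le> 1 / eps \<kappa> * log 2 (1 / eps \<kappa>)"
      using log_inverse_eps_nonneg[of \<kappa>] by (simp add: eps_def)
    then show "real (card (existing \<kappa> t k)) \<le> 16 * (1 / eps \<kappa> * log 2 (1 / eps \<kappa>))"
      using n_gam_le[OF \<kappa>] card_existing_le[of \<kappa> t k] by linarith
    show "real (card (G \<kappa> t)) \<le> 16 * (1 / eps \<kappa> * (log 2 (1 / eps \<kappa>))\<^sup>2)"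
      using rows_mult_n_gam_le[OF \<kappa>] card_G_le[of \<kappa> t] by linarith
  qed (simp_all add: finite_existing finite_G)
next
  show "\<exists>C>0. \<forall>\<kappa> I a_me a m.
        ukp_instance I \<longrightarrow> eps \<kappa> \<le> 1/4 \<longrightarrow> most_efficient I a_me \<longrightarrow>
        is_reduced \<kappa> I a_me a \<longrightarrow> glue_input \<kappa> a_me a m \<longrightarrow>
          (\<exists>t. is_glued_family \<kappa> a_me a t \<and>
             stores_family \<kappa> ''t_ex'' ''t_p'' ''t_s'' t (mem (run glue_alg m)) \<and>
             stores_backtracking \<kappa> a t (mem (run glue_alg m))) \<and>
          real (elapsed (run glue_alg m)) \<le> C * (1 / (eps \<kappa>)\<^sup>2 * (log 2 (1 / eps \<kappa>)) ^ 3) \<and>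
          finite (touched (run glue_alg m)) \<and>
          real (card (touched (run glue_alg m))) \<le> C * (1 / eps \<kappa> * (log 2 (1 / eps \<kappa>))\<^sup>2)"
  \<comment> \<open>Time requires \<open>300 * 128 = 38400\<close>; space requires only
    \<open>(16 + 9) * 16 = 400\<close>. The instantiated \<open>conjI\<close> splits off positivity
    of the constant and leaves the claim about the run in one piece.\<close>
  proof (rule exI[of _ 38400], intro conjI[of "0 < _"] allI impI)
    fix \<kappa> I a_me a m
    assume "ukp_instance I" "eps \<kappa> \<le> 1/4" "most_efficient I a_me" "is_reduced \<kappa> I a_me a"
      and input: "glue_input \<kappa> a_me a m"
    then interpret reduced_instance \<kappa> I a_me a
      by (simp only: reduced_instance_def eps_le_quarter_iff)
    note alg = glue_alg_correct[OF input]
    have time: "real (elapsed (run glue_alg m)) \<le> 38400 * (1 / (eps \<kappa>)\<^sup>2 * (log 2 (1 / eps \<kappa>)) ^ 3)"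
      using rows_mult_n_gam_square_le[OF kappa] alg(2) by linarith
    have "1 \<le> (\<kappa> + 1) * n_gam \<kappa>" using n_gam_pos[of \<kappa>] by simp
    then have "card (touched (run glue_alg m)) \<le> 25 * ((\<kappa> + 1) * n_gam \<kappa>)"
      using alg(4) by linarith
    then have space: "real (card (touched (run glue_alg m)))
        \<le> 38400 * (1 / eps \<kappa> * (log 2 (1 / eps \<kappa>))\<^sup>2)"
      using rows_mult_n_gam_le[OF kappa] by linarith
    show "(\<exists>t. is_glued_family \<kappa> a_me a t \<and>
             stores_family \<kappa> ''t_ex'' ''t_p'' ''t_s'' t (mem (run glue_alg m)) \<and>
             stores_backtracking \<kappa> a t (mem (run glue_alg m))) \<and>
          real (elapsed (run glue_alg m)) \<le> 38400 * (1 / (eps \<kappa>)\<^sup>2 * (log 2 (1 / eps \<kappa>)) ^ 3) \<and>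
          finite (touched (run glue_alg m)) \<and>
          real (card (touched (run glue_alg m))) \<le> 38400 * (1 / eps \<kappa> * (log 2 (1 / eps \<kappa>))\<^sup>2)"
      by (intro conjI alg(1,3) time space)
  qed simp
next
  show "\<exists>prog C. \<forall>\<kappa> I a_me a_eff m.
        ukp_instance I \<longrightarrow> eps \<kappa> \<le> 1/4 \<longrightarrow> most_efficient I a_me \<longrightarrow>
        most_efficient (I_S \<kappa> I a_me) a_eff \<longrightarrow> eff_input a_me a_eff m \<longrightarrow>
          stores_item ''c_ex'' ''c_p'' ''c_s'' 0 (a_eff_c a_me a_eff) (mem (run prog m)) \<and>
          elapsed (run prog m) \<le> C"
    by (intro exI[of _ eff_alg] exI[of _ 50] allI impI conjI eff_alg_correct)
qed

end
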